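(* For any $p\in(1,\infty)$, the spaces $H^{1,p}$ and $H^{1,\infty}$ coincide and their norms $\|\cdot\|_{H^{1,p}}$ and $\|\cdot\|_{H^{1,\infty}}$ are equivalent.
   Context: Let $d\geq 1$ be an integer and $S=\mathbb{R}^d\ltimes\mathbb{R}^+$ the group with product $(x,a)\cdot(x',a')=(x+a\,x',a\,a')$, endowed with the right Haar measure $d\rho(x,a)=a^{-1}\,dx\,da$. Write $L^p=L^p(S,\rho)$ with norm $\|\cdot\|_p$. A Calderón--Zygmund set is a set $R=Q\times[ae^{-r},ae^r]$, where $Q$ is a dyadic cube in $\mathbb{R}^d$ of side $L$, $a\in\mathbb{R}^+$, $r>0$, and $e^2ar\leq L<e^8ar$ if $r<1$, while $ae^{2r}\leq L<ae^{8r}$ if $r\geq1$. For $p\in(1,\infty]$, a $(1,p)$-atom is a function $a$ supported in a Calderón--Zygmund set $R$ such that $\|a\|_p\leq\rho(R)^{1/p-1}$ and $\int a\,d\rho=0$. The space $H^{1,p}$ consists of all $h\in L^1$ such that $h=\sum_j\lambda_ja_j$ with $a_j$ $(1,p)$-atoms and $\lambda_j$ complex numbers with $\sum_j|\lambda_j|<\infty$; $\|h\|_{H^{1,p}}$ is the infimum of $\sum_j|\lambda_j|$ over all such decompositions. *)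

theory Defs
  imports "HOL-Analysis.Analysis" "HOL-Probability.Essential_Supremum"
begin

text \<open>
  The group \<open>S\<close> is the half-space of pairs \<open>(x, a)\<close> with \<open>a > 0\<close>, and \<open>d = CARD('n)\<close>.
  Only the right Haar measure of \<open>(x, a) (x', a') = (x + a x', a a')\<close> is needed below, not the
  product itself.
\<close>

definition S_carrier :: "((real ^ 'n) \<times> real) set" where
  "S_carrier = UNIV \<times> {0<..}"

definition rho :: "((real ^ 'n) \<times> real) measure" where
  "rho = density (restrict_space lborel S_carrier) (\<lambda>(x, a). ennreal (1 / a))"

text \<open>
  The extended \<open>L\<^sup>p\<close> norm for \<open>0 < p \<le> \<infinity>\<close>; it is \<open>\<infinity>\<close> for measurable functions outside
  \<open>L\<^sup>p\<close>. Functions are identified almost everywhere, but represented by actual functions.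
\<close>

definition Lp_norm :: "'a measure \<Rightarrow> ennreal \<Rightarrow> ('a \<Rightarrow> complex) \<Rightarrow> ennreal" where
  "Lp_norm M p f =
     (if p = \<infinity> then esssup M (\<lambda>z. ennreal (norm (f z)))
      else if integrable M (\<lambda>z. norm (f z) powr enn2real p)
      then ennreal ((LINT z|M. norm (f z) powr enn2real p) powr (1 / enn2real p))
      else \<infinity>)"

text \<open>
  The dyadic cube of side \<open>2\<^sup>m\<close> with index \<open>k\<close>. Cubes are half-open; including the
  faces would only change Calderon-Zygmund sets by null sets.
\<close>

definition dyadic_cube :: "int \<Rightarrow> (int ^ 'n) \<Rightarrow> (real ^ 'n) set" where
  "dyadic_cube m k =
     {x. \<forall>i. of_int (k $ i) * 2 powi m \<le> x $ i \<and> x $ i < (of_int (k $ i) + 1) * 2 powi m}"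

definition cz_set :: "((real ^ 'n) \<times> real) set \<Rightarrow> bool" where
  "cz_set R \<longleftrightarrow>
     (\<exists>m k a r L. a > 0 \<and> r > 0 \<and> L = 2 powi m \<and>
        (if r < 1 then exp 2 * a * r \<le> L \<and> L < exp 8 * a * r
         else a * exp (2 * r) \<le> L \<and> L < a * exp (8 * r)) \<and>
        R = dyadic_cube m k \<times> {a * exp (- r)..a * exp r})"

text \<open>
  In \<open>ennreal\<close>, \<open>1 / \<infinity> = 0\<close>, so the size condition for \<open>p = \<infinity>\<close> is the bound by
  the inverse of the measure of \<open>R\<close>.
\<close>

definition atom :: "ennreal \<Rightarrow> ((real ^ 'n) \<times> real \<Rightarrow> complex) \<Rightarrow> bool" where
  "atom p f \<longleftrightarrow>
     (\<exists>R. cz_set R \<and> f \<in> borel_measurable rho \<and>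
        (AE z in rho. z \<notin> R \<longrightarrow> f z = 0) \<and>
        Lp_norm rho p f \<le> ennreal (measure rho R powr (enn2real (1 / p) - 1)) \<and>
        has_bochner_integral rho f 0)"

text \<open>
  The series converges to \<open>h\<close> in \<open>L\<^sup>1\<close>. Finite decompositions are included, since
  coefficients may vanish.
\<close>

definition atomic_decomp ::
  "ennreal \<Rightarrow> ((real ^ 'n) \<times> real \<Rightarrow> complex) \<Rightarrow>
   (nat \<Rightarrow> complex) \<Rightarrow> (nat \<Rightarrow> (real ^ 'n) \<times> real \<Rightarrow> complex) \<Rightarrow> bool" where
  "atomic_decomp p h c A \<longleftrightarrow>
     (\<forall>j. atom p (A j)) \<and> summable (\<lambda>j. norm (c j)) \<and>
     (\<lambda>n. Lp_norm rho 1 (\<lambda>z. h z - (\<Sum>j<n. c j * A j z))) \<longlonglongrightarrow> 0"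

definition H1 :: "ennreal \<Rightarrow> ((real ^ 'n) \<times> real \<Rightarrow> complex) set" where
  "H1 p = {h. integrable rho h \<and> (\<exists>c A. atomic_decomp p h c A)}"

definition H1_norm :: "ennreal \<Rightarrow> ((real ^ 'n) \<times> real \<Rightarrow> complex) \<Rightarrow> real" where
  "H1_norm p h = Inf {(\<Sum>j. norm (c j)) |c. \<exists>A. atomic_decomp p h c A}"

end

theory Submission
  imports Defs
begin

text \<open>
  A \<open>(1,\<infinity>)\<close>-atom is a \<open>(1,p)\<close>-atom, so \<open>H\<^sup>1\<^sup>,\<^sup>\<infinity>\<close> is contained in \<open>H\<^sup>1\<^sup>,\<^sup>p\<close> and there the
  \<open>H\<^sup>1\<^sup>,\<^sup>p\<close> norm is at most the \<open>H\<^sup>1\<^sup>,\<^sup>\<infinity>\<close> norm. For the converse it suffices to write every \<open>(1,p)\<close>-atom as a bounded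
  multiple \<open>K g\<close> of a \<open>(1,\<infinity>)\<close>-atom plus a series of \<open>(1,p)\<close>-atoms with coefficients of total size
  at most \<open>1 / 2\<close> (\<open>atom_reduction\<close>): applied to all atoms of a decomposition of \<open>h\<close>, and then again
  and again to the remainder, it turns a decomposition with total coefficient \<open>N\<close> into one by
  \<open>(1,\<infinity>)\<close>-atoms with total coefficient \<open>K N + K N / 2 + K N / 4 + \<dots> = 2 K N\<close> (\<open>atomic_sum_imp_top\<close>).

  The reduction of an atom is a Calderon--Zygmund decomposition. The measure \<open>\<rho>\<close> is not doubling,
  but no maximal function on the whole group is needed: an atom lives on one Calderon--Zygmund set,
  and everything happens inside it. Such a set splits into two or \<open>2\<^sup>d\<close> Calderon--Zygmund
  sets of equal measure, by halving either its interval or its cube (\<open>cz_cells_split\<close>), and sets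
  of small measure obtained in this way have small diameter (\<open>cz_cells_shrink\<close>). So a stopping-time
  argument as for dyadic cubes applies, with \<open>2\<^sup>d\<close> in the role of the doubling constant
  (\<open>calderon_zygmund_covering\<close>).
\<close>

section \<open>A stopping-time covering lemma\<close>

text \<open>
  Outer regularity for measures such as the restriction of a density to an open half-space: the
  measure may live on a proper subset of the topological space and be infinite, as long as it is
  finite on \<open>R\<close>. Pushing the part inside \<open>R\<close> forward to the Borel sets of the whole space
  reduces this to the regularity of finite Borel measures on Polish spaces.
\<close>

lemma emeasure_outer_open_Int:
  fixes M :: "'a::{second_countable_topology, complete_space} measure"
  assumes id: "(\<lambda>x. x) \<in> M \<rightarrow>\<^sub>M borel" and sub: "sets M \<subseteq> sets borel"
    and R: "R \<in> sets M" "emeasure M R < \<infinity>" and E: "E \<in> sets M" "E \<subseteq> R"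
  shows "emeasure M E = (INF U\<in>{U. E \<subseteq> U \<and> open U}. emeasure M (U \<inter> R))"
proof -
  define M' where "M' = distr (density M (indicator R)) borel (\<lambda>x. x)"
  have em: "emeasure M' A = emeasure M (A \<inter> R)" if "A \<in> sets borel" for A
  proof -
    have "A \<inter> space M \<in> sets M" using measurable_sets[OF id that] by simp
    then have "emeasure M' A = emeasure (density M (indicator R)) (A \<inter> space M)"
      unfolding M'_def using that id
      by (subst emeasure_distr) auto
    also have "\<dots> = emeasure M (R \<inter> (A \<inter> space M))"
      using R(1) \<open>A \<inter> space M \<in> sets M\<close> by (subst emeasure_density) (auto simp flip: indicator_inter_arith nn_integral_indicator intro!: nn_integral_cong split: split_indicator)
    also have "R \<inter> (A \<inter> space M) = A \<inter> R"
      using sets.sets_into_space[OF R(1)] by auto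
    finally show ?thesis .
  qed
  have "emeasure M' (space M') < \<infinity>" using em[of UNIV] R(2) by (simp add: M'_def)
  then have "emeasure M' E = (INF U\<in>{U. E \<subseteq> U \<and> open U}. emeasure M' U)"
    using E(1) sub by (intro outer_regular) (auto simp: M'_def)
  also have "\<dots> = (INF U\<in>{U. E \<subseteq> U \<and> open U}. emeasure M (U \<inter> R))"
    by (intro INF_cong) (auto simp: em)
  finally have "emeasure M' E = (INF U\<in>{U. E \<subseteq> U \<and> open U}. emeasure M (U \<inter> R))" .
  moreover have "E \<inter> R = E" using E by auto
  ultimately show ?thesis using em[of E] E sub by auto
qed

text \<open>
  The stopping-time selection, for two measures in place of a measure and a function: starting
  from \<open>R\<close>, whose average \<open>N R / M R\<close> is at most \<open>t\<close>, keep subdividing and stop at a cell as soon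
  as its average exceeds \<open>t\<close>. A stopped cell has a parent of average at most \<open>t\<close>, which costs only
  the factor \<open>D\<close>. A point outside the stopped cells lies in cells of average at most \<open>t\<close> of
  arbitrarily small diameter, so there \<open>N\<close> is dominated by \<open>t\<close> times \<open>M\<close>. The last conclusion says
  this setwise and replaces the Lebesgue differentiation theorem: an open neighbourhood of \<open>E\<close>
  nearly of the measure of \<open>E\<close> contains, for each point of \<open>E\<close>, all late enough cells around it.
\<close>

lemma calderon_zygmund_covering:
  fixes M N :: "'a::{second_countable_topology, complete_space} measure"
    and \<D> :: "'a set set" and t D :: ennreal
  assumes id: "(\<lambda>x. x) \<in> M \<rightarrow>\<^sub>M borel" and sub: "sets M \<subseteq> sets borel"
    and cells: "\<And>C. C \<in> \<D> \<Longrightarrow> C \<in> sets M"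
    and split: "\<And>C. C \<in> \<D> \<Longrightarrow> \<exists>\<C>\<subseteq>\<D>. finite \<C> \<and> disjoint \<C> \<and> \<Union>\<C> = C \<and>
      (\<forall>C'\<in>\<C>. emeasure M C \<le> D * emeasure M C' \<and> 2 * emeasure M C' \<le> emeasure M C)"
    and R: "R \<in> \<D>" "emeasure M R < \<infinity>"
    and shrink: "\<And>e::real. e > 0 \<Longrightarrow> \<exists>\<delta>::real>0. \<forall>C\<in>\<D>. C \<subseteq> R \<longrightarrow> emeasure M C < ennreal \<delta> \<longrightarrow>
      (\<forall>x\<in>C. \<forall>y\<in>C. dist x y < e)"
    and N: "sets N = sets M" and t: "t < \<infinity>" and avg: "emeasure N R \<le> t * emeasure M R"
  obtains \<B> where "\<B> \<subseteq> \<D>" "countable \<B>" "disjoint \<B>"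
    "\<And>B. B \<in> \<B> \<Longrightarrow> B \<subseteq> R"
    "\<And>B. B \<in> \<B> \<Longrightarrow> t * emeasure M B \<le> emeasure N B"
    "\<And>B. B \<in> \<B> \<Longrightarrow> emeasure N B \<le> t * (D * emeasure M B)"
    "\<And>E. E \<in> sets M \<Longrightarrow> E \<subseteq> R - \<Union>\<B> \<Longrightarrow> emeasure N E \<le> t * emeasure M E"
proof -
  obtain ch where ch: "\<And>C. C \<in> \<D> \<Longrightarrow> ch C \<subseteq> \<D>" "\<And>C. C \<in> \<D> \<Longrightarrow> finite (ch C)"
      "\<And>C. C \<in> \<D> \<Longrightarrow> disjoint (ch C)" "\<And>C. C \<in> \<D> \<Longrightarrow> \<Union>(ch C) = C"
      "\<And>C C'. C \<in> \<D> \<Longrightarrow> C' \<in> ch C \<Longrightarrow> emeasure M C \<le> D * emeasure M C'"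
      "\<And>C C'. C \<in> \<D> \<Longrightarrow> C' \<in> ch C \<Longrightarrow> 2 * emeasure M C' \<le> emeasure M C"
  proof -
    have "\<forall>C\<in>\<D>. \<exists>\<C>. \<C> \<subseteq> \<D> \<and> finite \<C> \<and> disjoint \<C> \<and> \<Union>\<C> = C \<and>
      (\<forall>C'\<in>\<C>. emeasure M C \<le> D * emeasure M C' \<and> 2 * emeasure M C' \<le> emeasure M C)"
      using split by blast
    from bchoice[OF this] obtain ch where "\<forall>C\<in>\<D>. ch C \<subseteq> \<D> \<and> finite (ch C) \<and> disjoint (ch C) \<and> \<Union>(ch C) = C \<and>
      (\<forall>C'\<in>ch C. emeasure M C \<le> D * emeasure M C' \<and> 2 * emeasure M C' \<le> emeasure M C)" ..
    then show ?thesis by (intro that[of ch]) auto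
  qed
  define good where "good C \<longleftrightarrow> emeasure N C \<le> t * emeasure M C" for C
  \<comment> \<open>\<open>G n\<close> consists of the \<open>n\<close>-th generation cells not inside a stopped cell; \<open>B n\<close> of the
    cells of generation \<open>n + 1\<close> at which the subdivision stops\<close>
  define G where "G = rec_nat {R} (\<lambda>_ \<G>. {C \<in> \<Union>(ch ` \<G>). good C})"
  have G0: "G 0 = {R}" and GS: "\<And>n. G (Suc n) = {C \<in> \<Union>(ch ` G n). good C}"
    by (simp_all add: G_def)
  define B where "B n = {C \<in> \<Union>(ch ` G n). \<not> good C}" for n
  have G: "G n \<subseteq> \<D> \<and> finite (G n)" for n
  proof (induction n)
    case (Suc n)
    then have "G (Suc n) \<subseteq> \<Union>(ch ` G n)" "\<Union>(ch ` G n) \<subseteq> \<D>" "finite (\<Union>(ch ` G n))"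
      using ch(1,2) unfolding GS by blast+
    then show ?case by (meson finite_subset order_trans)
  qed (use R in \<open>simp add: G0\<close>)
  then have GD: "C \<in> \<D>" if "C \<in> G n" for C n using that by auto
  have Ggood: "good C" if "C \<in> G n" for C n
    using that avg by (cases n) (auto simp: G0 GS good_def)
  have small: "2 ^ n * emeasure M C \<le> emeasure M R" if "C \<in> G n" for C n
    using that
  proof (induction n arbitrary: C)
    case (Suc n)
    then obtain X where X: "X \<in> G n" "C \<in> ch X" by (auto simp: GS)
    have "2 ^ Suc n * emeasure M C = 2 ^ n * (2 * emeasure M C)" by (simp add: algebra_simps)
    also have "\<dots> \<le> 2 ^ n * emeasure M X"
      using ch(6)[OF GD[OF X(1)] X(2)] by (intro mult_left_mono) auto
    also have "\<dots> \<le> emeasure M R" using Suc.IH X by auto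
    finally show ?case .
  qed (auto simp: G0)
  have disjD: "a \<inter> b = {}" if "disjoint \<F>" "a \<in> \<F>" "b \<in> \<F>" "a \<noteq> b" for \<F> :: "'a set set" and a b
    using that unfolding disjoint_def by blast
  have disj_ch: "disjoint (\<Union>(ch ` \<G>))" if "\<G> \<subseteq> \<D>" "disjoint \<G>" for \<G>
    unfolding disjoint_def
  proof (intro ballI impI)
    fix a b assume ab: "a \<in> \<Union>(ch ` \<G>)" "b \<in> \<Union>(ch ` \<G>)" "a \<noteq> b"
    then obtain X Y where XY: "X \<in> \<G>" "a \<in> ch X" "Y \<in> \<G>" "b \<in> ch Y" by auto
    then have "a \<subseteq> X" "b \<subseteq> Y" using ch(4) that(1) by blast+
    then show "a \<inter> b = {}"
      using XY ab(3) disjD[OF ch(3), of X a b] disjD[OF that(2), of X Y] that(1)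
      by (cases "X = Y") blast+
  qed
  have Gdisj: "disjoint (G n)" for n
  proof (induction n)
    case (Suc n)
    then have "disjoint (\<Union>(ch ` G n))" using disj_ch[of "G n"] G[of n] by blast
    then show ?case unfolding GS by (rule pairwise_subset) blast
  qed (simp add: G0)
  have chdisj: "disjoint (\<Union>(ch ` G n))" for n using disj_ch[of "G n"] Gdisj[of n] G[of n] by blast
  have chU: "\<Union>(\<Union>(ch ` G n)) = \<Union>(G n)" for n
  proof -
    have "\<Union>(\<Union>(ch ` G n)) = (\<Union>X\<in>G n. \<Union>(ch X))" by blast
    also have "\<dots> = (\<Union>X\<in>G n. X)" using ch(4) GD by (intro SUP_cong) auto
    finally show ?thesis by simp
  qed
  have UG: "\<Union>(G n) = \<Union>(G (Suc n)) \<union> \<Union>(B n)" for n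
    unfolding chU[symmetric, of n] GS B_def by auto
  have Gdec: "\<Union>(G (n + k)) \<subseteq> \<Union>(G n)" for n k
  proof (induction k)
    case (Suc k)
    have "\<Union>(G (n + Suc k)) \<subseteq> \<Union>(G (n + k))" using UG[of "n + k"] by (metis Un_upper1 add_Suc_right)
    then show ?case using Suc by blast
  qed simp
  have GR: "\<Union>(G n) \<subseteq> R" for n using Gdec[of 0 n] by (simp add: G0)
  have BG: "b \<inter> \<Union>(G (Suc n)) = {}" if "b \<in> B n" for b n
  proof -
    have "b \<inter> c = {}" if "c \<in> G (Suc n)" for c
    proof (rule disjD[OF chdisj[of n]])
      show "b \<noteq> c" using \<open>b \<in> B n\<close> that unfolding GS B_def by blast
    qed (use \<open>b \<in> B n\<close> that in \<open>auto simp: GS B_def\<close>)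
    then show ?thesis by auto
  qed
  have Bdisj': "b \<inter> c = {}" if "b \<in> B i" "c \<in> B j" "i < j" for b c i j
  proof -
    have "c \<subseteq> \<Union>(G j)" using that(2) UG[of j] by auto
    also have "\<dots> \<subseteq> \<Union>(G (Suc i))" using Gdec[of "Suc i" "j - Suc i"] that(3) by simp
    finally show ?thesis using BG[OF that(1)] by blast
  qed
  have Bdisj: "disjoint (\<Union>n. B n)" unfolding disjoint_def
  proof (intro ballI impI)
    fix b c assume bc: "b \<in> (\<Union>n. B n)" "c \<in> (\<Union>n. B n)" "b \<noteq> c"
    then obtain i j where ij: "b \<in> B i" "c \<in> B j" by auto
    consider "i < j" | "j < i" | "i = j" by linarith
    then show "b \<inter> c = {}"
    proof cases
      case 3
      then show ?thesis using ij bc(3) by (intro disjD[OF chdisj[of i]]) (auto simp: B_def)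
    next
      case 1
      then show ?thesis using Bdisj'[OF ij] by blast
    next
      case 2
      then show ?thesis using Bdisj'[OF ij(2) ij(1)] by blast
    qed
  qed
  have Bpar: "\<exists>X n. X \<in> G n \<and> b \<in> ch X \<and> \<not> good b" if "b \<in> (\<Union>n. B n)" for b
    using that by (auto simp: B_def)
  have BD: "(\<Union>n. B n) \<subseteq> \<D>"
    using Bpar GD ch(1) by blast
  have BR: "b \<subseteq> R" if "b \<in> (\<Union>n. B n)" for b
    using that UG GR by blast
  have rest: "x \<in> \<Union>(G n)" if "x \<in> R - \<Union>(\<Union>n. B n)" for x n
  proof (induction n)
    case (Suc n)
    then show ?case using that UG[of n] by auto
  qed (use that in \<open>simp add: G0\<close>)
  have NE: "emeasure N E \<le> t * emeasure M E" if E: "E \<in> sets M" "E \<subseteq> R - \<Union>(\<Union>n. B n)" for E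
  proof -
    have U: "emeasure N E \<le> t * emeasure M (U \<inter> R)" if U: "open U" "E \<subseteq> U" for U
    proof -
      \<comment> \<open>the sets \<open>V n\<close> need not increase, but \<open>E \<inter> V n\<close> does, since \<open>E\<close> meets no stopped cell\<close>
      define V where "V n = \<Union>{C \<in> G n. C \<subseteq> U}" for n
      have Vs: "V n \<in> sets M" for n
      proof -
        have "{C \<in> G n. C \<subseteq> U} \<subseteq> sets M" using cells[OF GD] by blast
        then show ?thesis unfolding V_def using G[of n] by (intro sets.finite_Union) simp_all
      qed
      have step: "E \<inter> V n \<subseteq> V (Suc n)" for n
      proof
        fix x assume x: "x \<in> E \<inter> V n"
        then obtain C where C: "x \<in> C" "C \<in> G n" "C \<subseteq> U" unfolding V_def by blast
        have "x \<in> \<Union>(G (Suc n))" using x E(2) by (intro rest) blast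
        then obtain C' where C': "x \<in> C'" "C' \<in> G (Suc n)" by (rule UnionE)
        then obtain X where X: "X \<in> G n" "C' \<in> ch X" by (auto simp: GS)
        then have "C' \<subseteq> X" using ch(4)[OF GD[OF X(1)]] X(2) by blast
        then have "X = C" using disjD[OF Gdisj[of n] X(1) C(2)] C(1) C'(1) \<open>C' \<subseteq> X\<close> by blast
        then have "C' \<subseteq> U" using \<open>C' \<subseteq> X\<close> C(3) by blast
        then show "x \<in> V (Suc n)" using C' unfolding V_def by blast
      qed
      have cover: "(\<Union>n. E \<inter> V n) = E"
      proof -
        have "\<exists>n. x \<in> V n" if x: "x \<in> E" for x
        proof -
          have "x \<in> U" using U(2) x by blast
          then obtain e where e: "e > 0" "ball x e \<subseteq> U" by (rule openE[OF U(1)])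
          from shrink[OF e(1)] obtain \<delta> :: real where d': "\<delta> > 0 \<and> (\<forall>C\<in>\<D>. C \<subseteq> R \<longrightarrow>
              emeasure M C < ennreal \<delta> \<longrightarrow> (\<forall>x\<in>C. \<forall>y\<in>C. dist x y < e))" ..
          note d = d'[THEN conjunct1] and diam = d'[THEN conjunct2, rule_format]
          obtain m where m: "emeasure M R = ennreal m" "m \<ge> 0"
            using R(2) by (cases "emeasure M R" rule: ennreal_cases) auto
          obtain n where "m / \<delta> < 2 ^ n" using real_arch_pow[of 2 "m / \<delta>"] by auto
          then have "m < 2 ^ n * \<delta>" using d by (simp add: field_simps)
          then have "emeasure M R < ennreal (2 ^ n * \<delta>)" using m d by (simp add: ennreal_lessI)
          also have "\<dots> = ennreal (2 ^ n) * ennreal \<delta>" by (rule ennreal_mult') simp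
          also have "ennreal (2 ^ n) = 2 ^ n" by (simp flip: ennreal_power)
          finally have n: "emeasure M R < 2 ^ n * ennreal \<delta>" .
          have "x \<in> \<Union>(G n)" using x E(2) by (intro rest) blast
          then obtain C where C: "C \<in> G n" "x \<in> C" by (rule UnionE)
          have "emeasure M C < ennreal \<delta>"
          proof (rule ccontr)
            assume "\<not> ?thesis"
            then have "2 ^ n * ennreal \<delta> \<le> 2 ^ n * emeasure M C" by (intro mult_left_mono) auto
            then show False using small[OF C(1)] n by (meson leD order_trans)
          qed
          moreover have "C \<subseteq> R" using GR[of n] C(1) by blast
          ultimately have "dist x y < e" if "y \<in> C" for y
            using diam[of C x y] GD[OF C(1)] C(2) that by simp
          then have "C \<subseteq> ball x e" unfolding ball_def by blast
          then have "x \<in> V n" using e(2) C unfolding V_def by blast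
          then show ?thesis ..
        qed
        then show ?thesis by blast
      qed
      have bd: "emeasure N (E \<inter> V n) \<le> t * emeasure M (U \<inter> R)" for n
      proof -
        let ?F = "{C \<in> G n. C \<subseteq> U}"
        have F: "finite ?F" "disjoint_family_on (\<lambda>C. C) ?F" "?F \<subseteq> sets M"
          using G[of n] cells GD disjD[OF Gdisj[of n]] by (auto simp: disjoint_family_on_def)
        have "U \<inter> space M \<in> sets M" using measurable_sets[OF id, of U] U by simp
        then have "U \<inter> space M \<inter> R \<in> sets M" using cells[OF R(1)] by auto
        moreover have "U \<inter> space M \<inter> R = U \<inter> R" using sets.sets_into_space[OF cells[OF R(1)]] by auto
        ultimately have UR: "U \<inter> R \<in> sets M" by simp
        have "emeasure N (E \<inter> V n) \<le> emeasure N (V n)"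
          using Vs N by (intro emeasure_mono) auto
        also have "\<dots> = (\<Sum>C\<in>?F. emeasure N C)"
          using F N sum_emeasure[of "\<lambda>C. C" ?F N] by (simp add: V_def)
        also have "\<dots> \<le> (\<Sum>C\<in>?F. t * emeasure M C)"
          using Ggood by (intro sum_mono) (auto simp: good_def)
        also have "\<dots> = t * emeasure M (V n)"
          using F sum_emeasure[of "\<lambda>C. C" ?F M] by (simp add: V_def flip: sum_distrib_left)
        also have "\<dots> \<le> t * emeasure M (U \<inter> R)"
          using GR[of n] UR by (intro mult_left_mono emeasure_mono) (auto simp: V_def)
        finally show ?thesis .
      qed
      have "incseq (\<lambda>n. E \<inter> V n)" using step by (intro incseq_SucI) auto
      then have "emeasure N E = (SUP n. emeasure N (E \<inter> V n))"
      proof -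
        have "range (\<lambda>n. E \<inter> V n) \<subseteq> sets N" using E(1) Vs N by auto
        then show ?thesis using SUP_emeasure_incseq[of "\<lambda>n. E \<inter> V n" N] \<open>incseq _\<close> unfolding cover by simp
      qed
      also have "\<dots> \<le> t * emeasure M (U \<inter> R)" using bd by (intro SUP_least) auto
      finally show ?thesis .
    qed
    show ?thesis
    proof (cases "t = 0")
      case True
      then show ?thesis using U[of UNIV] by simp
    next
      case False
      have outer: "emeasure M E = (INF U\<in>{U. E \<subseteq> U \<and> open U}. emeasure M (U \<inter> R))"
        using E(2) by (intro emeasure_outer_open_Int[OF id sub cells[OF R(1)] R(2) E(1)]) auto
      have div: "emeasure N E / t \<le> emeasure M E"
        unfolding outer
      proof (intro INF_greatest)
        fix U assume "U \<in> {U. E \<subseteq> U \<and> open U}"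
        then show "emeasure N E / t \<le> emeasure M (U \<inter> R)"
          using U[of U] False by (intro divide_le_posI_ennreal) (simp_all add: zero_less_iff_neq_zero)
      qed
      have "emeasure N E = emeasure N E / t * t"
        using False t by (simp add: ennreal_divide_times)
      also have "\<dots> \<le> emeasure M E * t" using div by (intro mult_right_mono) auto
      finally show ?thesis by (simp add: mult.commute)
    qed
  qed
  show ?thesis
  proof (rule that[of "\<Union>n. B n"])
    show "countable (\<Union>n. B n)"
    proof (rule countable_UN)
      show "countable (B n)" for n
      proof (rule countable_finite)
        have "finite (\<Union>(ch ` G n))" using G[of n] ch(2) by blast
        then show "finite (B n)" by (rule finite_subset[rotated]) (auto simp: B_def)
      qed
    qed simp
    fix b assume b: "b \<in> (\<Union>n. B n)"
    then obtain X n where X: "X \<in> G n" "b \<in> ch X" "\<not> good b" using Bpar by blast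
    show "t * emeasure M b \<le> emeasure N b" using X by (simp add: good_def)
    have "b \<subseteq> X" using X(2) ch(4)[OF GD[OF X(1)]] by blast
    then have "emeasure N b \<le> emeasure N X" using cells[OF GD[OF X(1)]] N by (intro emeasure_mono) auto
    also have "\<dots> \<le> t * emeasure M X" using Ggood[OF X(1)] by (simp add: good_def)
    also have "\<dots> \<le> t * (D * emeasure M b)" using ch(5)[OF GD[OF X(1)] X(2)] by (intro mult_left_mono) auto
    finally show "emeasure N b \<le> t * (D * emeasure M b)" .
  qed (fact BD Bdisj BR NE)+
qed

section \<open>Calderon--Zygmund cells and their measure\<close>

definition cz_shape :: "int \<Rightarrow> real \<Rightarrow> real \<Rightarrow> bool" where
  "cz_shape m a r \<longleftrightarrow> a > 0 \<and> r > 0 \<and>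
     (if r < 1 then exp 2 * a * r \<le> 2 powi m \<and> 2 powi m < exp 8 * a * r
      else a * exp (2 * r) \<le> 2 powi m \<and> 2 powi m < a * exp (8 * r))"

text \<open>
  Closed Calderon--Zygmund sets cannot be subdivided into disjoint ones, hence the intervals are
  taken half-open here; \<open>cz_set_cell\<close> and \<open>cell_cz_set\<close> pass between the two versions.
\<close>

definition cz_cell :: "int \<Rightarrow> (int ^ 'n) \<Rightarrow> real \<Rightarrow> real \<Rightarrow> ((real ^ 'n) \<times> real) set" where
  "cz_cell m k a r = dyadic_cube m k \<times> {a * exp (- r)..<a * exp r}"

definition cz_cells :: "((real ^ 'n) \<times> real) set set" where
  "cz_cells = {cz_cell m k a r |m k a r. cz_shape m a r}"

lemma borel_measurable_component [measurable]: "(\<lambda>x::real^'n. x $ i) \<in> borel_measurable borel"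
  by (intro borel_measurable_continuous_onI continuous_intros)

lemma dyadic_cube_borel [measurable]: "dyadic_cube m k \<in> sets borel"
  unfolding dyadic_cube_def by measurable

lemma emeasure_dyadic_cube:
  "emeasure lborel (dyadic_cube m k :: (real^'n) set) = ennreal ((2 powi m) ^ CARD('n))"
proof -
  define l u :: "real^'n" where "l = (\<chi> i. of_int (k $ i) * 2 powi m)" and "u = (\<chi> i. (of_int (k $ i) + 1) * 2 powi m)"
  have lu: "l \<bullet> b \<le> u \<bullet> b \<and> (u - l) \<bullet> b = 2 powi m" if b: "b \<in> Basis" for b
  proof -
    obtain i where i: "b = axis i 1" using b by (auto simp: Basis_vec_def)
    show ?thesis unfolding i by (simp add: inner_axis l_def u_def algebra_simps)
  qed
  have 1: "(\<Prod>b\<in>Basis. (u - l) \<bullet> b) = (2 powi m) ^ CARD('n)"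
    using lu by simp
  have sub: "box l u \<subseteq> dyadic_cube m k" "dyadic_cube m k \<subseteq> cbox l u"
    by (auto simp: box_def cbox_def Basis_vec_def inner_axis dyadic_cube_def l_def u_def less_imp_le)
  have "emeasure lborel (box l u) \<le> emeasure lborel (dyadic_cube m k)"
    by (intro emeasure_mono sub) simp
  moreover have "emeasure lborel (dyadic_cube m k) \<le> emeasure lborel (cbox l u)"
    by (intro emeasure_mono sub) simp
  ultimately show ?thesis using lu 1 by (simp add: antisym)
qed

lemma dyadic_cube_nonempty: "dyadic_cube m k \<noteq> {}"
proof -
  have "(\<chi> i. of_int (k $ i) * 2 powi m) \<in> dyadic_cube m k" by (simp add: dyadic_cube_def)
  then show ?thesis by blast
qed

lemma S_carrier_borel: "(S_carrier :: ((real^'n) \<times> real) set) \<in> sets borel"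
  unfolding S_carrier_def by (simp add: borel_Times)

lemma space_rho: "space rho = S_carrier"
  by (simp add: rho_def space_restrict_space)

lemma sets_rho: "X \<in> sets rho \<longleftrightarrow> X \<in> sets borel \<and> X \<subseteq> S_carrier"
  by (auto simp: rho_def sets_restrict_space_iff S_carrier_borel)

lemma id_rho_borel: "(\<lambda>x. x) \<in> rho \<rightarrow>\<^sub>M borel"
  unfolding rho_def by (simp add: measurable_restrict_space1)

lemma emeasure_rho:
  fixes X :: "((real^'n) \<times> real) set"
  assumes X: "X \<in> sets borel" "X \<subseteq> S_carrier"
  shows "emeasure rho X = (\<integral>\<^sup>+x. \<integral>\<^sup>+a. ennreal (1 / a) * indicator X (x, a) \<partial>lborel \<partial>lborel)"
proof -
  have S [measurable]: "(S_carrier :: ((real^'n) \<times> real) set) \<in> sets (borel \<Otimes>\<^sub>M borel)"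
      and X' [measurable]: "X \<in> sets (borel \<Otimes>\<^sub>M borel)"
    using X(1) by (simp_all only: borel_prod S_carrier_borel)
  have Xl: "X \<in> sets (restrict_space lborel S_carrier)"
    using X by (simp add: sets_restrict_space_iff S_carrier_borel)
  have m: "(\<lambda>(x::real^'n, a::real). ennreal (1 / a)) \<in> borel_measurable (borel \<Otimes>\<^sub>M borel)"
    by measurable
  then have m': "(\<lambda>(x::real^'n, a::real). ennreal (1 / a)) \<in> borel_measurable (restrict_space lborel S_carrier)"
    by (simp add: measurable_restrict_space1 borel_prod)
  have "emeasure rho X = (\<integral>\<^sup>+z. (case z of (x, a) \<Rightarrow> ennreal (1 / a)) * indicator X z \<partial>restrict_space lborel S_carrier)"
    unfolding rho_def using Xl m' by (subst emeasure_density) auto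
  also have "\<dots> = (\<integral>\<^sup>+z. (case z of (x, a) \<Rightarrow> ennreal (1 / a)) * indicator X z * indicator S_carrier z \<partial>lborel)"
    by (subst nn_integral_restrict_space) (auto simp: S_carrier_borel)
  also have "\<dots> = (\<integral>\<^sup>+z. (case z of (x, a) \<Rightarrow> ennreal (1 / a)) * indicator X z \<partial>(lborel \<Otimes>\<^sub>M lborel))"
    unfolding lborel_prod using X(2) by (intro nn_integral_cong) (auto split: split_indicator)
  also have "\<dots> = (\<integral>\<^sup>+x. \<integral>\<^sup>+a. ennreal (1 / a) * indicator X (x, a) \<partial>lborel \<partial>lborel)"
    by (subst lborel.nn_integral_fst[symmetric]) (auto)
  finally show ?thesis .
qed

text \<open>
  Leaving the right end point of \<open>I\<close> open covers closed sets and half-open cells at once.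
\<close>

lemma emeasure_rho_times:
  fixes A :: "(real^'n) set"
  assumes A: "A \<in> sets borel" and bc: "0 < b" "b \<le> c" and I: "{b..<c} \<subseteq> I" "I \<subseteq> {b..c}" "I \<in> sets borel"
  shows "emeasure rho (A \<times> I) = emeasure lborel A * ennreal (ln c - ln b)"
proof -
  have sub: "A \<times> I \<subseteq> S_carrier" using I bc by (auto simp: S_carrier_def)
  have "emeasure rho (A \<times> I) = (\<integral>\<^sup>+x. \<integral>\<^sup>+a. ennreal (1 / a) * indicator (A \<times> I) (x, a) \<partial>lborel \<partial>lborel)"
    using A I sub by (intro emeasure_rho) (auto simp: borel_Times)
  also have "\<dots> = (\<integral>\<^sup>+x. indicator A x * (\<integral>\<^sup>+a. ennreal (1 / a) * indicator I a \<partial>lborel) \<partial>lborel)"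
  proof (intro nn_integral_cong)
    fix x :: "real^'n"
    have "(\<integral>\<^sup>+a. ennreal (1 / a) * indicator (A \<times> I) (x, a) \<partial>lborel) = (\<integral>\<^sup>+a. indicator A x * (ennreal (1 / a) * indicator I a) \<partial>lborel)"
      by (intro nn_integral_cong) (auto split: split_indicator)
    also have "\<dots> = indicator A x * (\<integral>\<^sup>+a. ennreal (1 / a) * indicator I a \<partial>lborel)"
      using I(3) by (intro nn_integral_cmult) auto
    finally show "(\<integral>\<^sup>+a. ennreal (1 / a) * indicator (A \<times> I) (x, a) \<partial>lborel) = indicator A x * (\<integral>\<^sup>+a. ennreal (1 / a) * indicator I a \<partial>lborel)" .
  qed
  also have "\<dots> = emeasure lborel A * (\<integral>\<^sup>+a. ennreal (1 / a) * indicator I a \<partial>lborel)"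
    using A by (subst nn_integral_multc) auto
  also have "(\<integral>\<^sup>+a. ennreal (1 / a) * indicator I a \<partial>lborel) = (\<integral>\<^sup>+a. ennreal (1 / a) * indicator {b..c} a \<partial>lborel)"
  proof (intro nn_integral_cong_AE)
    show "AE a in lborel. ennreal (1 / a) * indicator I a = ennreal (1 / a) * indicator {b..c} a"
      using AE_lborel_singleton[of c]
    proof eventually_elim
      case (elim a)
      then have "a \<in> I \<longleftrightarrow> a \<in> {b..c}" using I by auto
      then show ?case by (simp split: split_indicator)
    qed
  qed
  also have "\<dots> = ennreal (ln c - ln b)"
    using bc by (intro nn_integral_FTC_Icc) (auto intro!: derivative_eq_intros)
  finally show ?thesis .
qed

lemma emeasure_rho_box:
  assumes "a > 0" "r > 0" "{a * exp (- r)..<a * exp r} \<subseteq> I" "I \<subseteq> {a * exp (- r)..a * exp r}" "I \<in> sets borel"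
  shows "emeasure rho (dyadic_cube m k \<times> I :: ((real^'n) \<times> real) set) = ennreal (2 * r * (2 powi m) ^ CARD('n))"
proof -
  have "ln (a * exp r) - ln (a * exp (- r)) = 2 * r" using assms(1) by (simp add: ln_mult)
  then show ?thesis
    using assms by (subst emeasure_rho_times[OF _ _ _ assms(3-5)])
      (auto simp: emeasure_dyadic_cube mult.commute simp flip: ennreal_mult)
qed

lemma emeasure_cz_cell:
  assumes "a > 0" "r > 0"
  shows "emeasure rho (cz_cell m k a r :: ((real^'n) \<times> real) set) = ennreal (2 * r * (2 powi m) ^ CARD('n))"
  unfolding cz_cell_def using assms by (intro emeasure_rho_box) auto

lemma emeasure_cz_box:
  assumes "a > 0" "r > 0"
  shows "emeasure rho (dyadic_cube m k \<times> {a * exp (- r)..a * exp r} :: ((real^'n) \<times> real) set) =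
    ennreal (2 * r * (2 powi m) ^ CARD('n))"
  using assms by (intro emeasure_rho_box) auto

lemma cz_cells_sets: "C \<in> cz_cells \<Longrightarrow> C \<in> sets rho"
proof -
  assume "C \<in> cz_cells"
  then obtain m k a r where C: "C = cz_cell m k a r" "a > 0"
    by (auto simp: cz_cells_def cz_shape_def)
  have "0 < a * exp (- r)" using C by simp
  then have "C \<subseteq> S_carrier" unfolding C(1) cz_cell_def S_carrier_def by (auto intro: less_le_trans)
  then show ?thesis unfolding sets_rho unfolding C(1) cz_cell_def by (simp add: borel_Times)
qed

lemma emeasure_cz_cells: "C \<in> cz_cells \<Longrightarrow> 0 < emeasure rho C \<and> emeasure rho C < \<infinity>"
  by (auto simp: cz_cells_def cz_shape_def emeasure_cz_cell)

lemma AE_rho_snd_neq: "AE z in (rho :: ((real^'n) \<times> real) measure). snd z \<noteq> c"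
proof (cases "c > 0")
  case True
  have m: "UNIV \<times> {c} \<in> sets (rho :: ((real^'n) \<times> real) measure)"
    using True by (auto simp: sets_rho S_carrier_def borel_Times)
  have "emeasure (rho :: ((real^'n) \<times> real) measure) (UNIV \<times> {c}) = emeasure lborel (UNIV :: (real^'n) set) * ennreal (ln c - ln c)"
    using True by (intro emeasure_rho_times) auto
  then have "UNIV \<times> {c} \<in> null_sets (rho :: ((real^'n) \<times> real) measure)" using m by auto
  then show ?thesis by (rule AE_I') auto
next
  case False
  then show ?thesis using AE_space[of rho] by (auto simp: space_rho S_carrier_def)
qed

lemma cz_set_cell:
  assumes "cz_set (R :: ((real^'n) \<times> real) set)"
  obtains C where "C \<in> cz_cells" "C \<subseteq> R" "emeasure rho C = emeasure rho R" "AE z in rho. z \<in> R \<longrightarrow> z \<in> C"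
proof -
  obtain m k a r where 1: "cz_shape m a r" and R: "R = dyadic_cube m k \<times> {a * exp (- r)..a * exp r}"
    using assms unfolding cz_set_def cz_shape_def by blast
  have ar: "a > 0" "r > 0" using 1 by (auto simp: cz_shape_def)
  show ?thesis
  proof
    show "cz_cell m k a r \<in> cz_cells" using 1 by (auto simp: cz_cells_def)
    show "cz_cell m k a r \<subseteq> R" by (auto simp: R cz_cell_def)
    show "emeasure rho (cz_cell m k a r) = emeasure rho R"
      unfolding R using ar by (simp add: emeasure_cz_cell emeasure_cz_box)
    show "AE z in rho. z \<in> R \<longrightarrow> z \<in> cz_cell m k a r"
      using AE_rho_snd_neq[of "a * exp r"] by eventually_elim (auto simp: R cz_cell_def)
  qed
qed

lemma cell_cz_set:
  assumes "(C :: ((real^'n) \<times> real) set) \<in> cz_cells"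
  obtains R where "cz_set R" "C \<subseteq> R" "emeasure rho R = emeasure rho C"
proof -
  obtain m k a r where 1: "cz_shape m a r" and C: "C = cz_cell m k a r"
    using assms unfolding cz_cells_def by blast
  have ar: "a > 0" "r > 0" using 1 by (auto simp: cz_shape_def)
  show ?thesis
  proof
    show "cz_set (dyadic_cube m k \<times> {a * exp (- r)..a * exp r})"
      using 1 unfolding cz_set_def cz_shape_def by blast
    show "C \<subseteq> dyadic_cube m k \<times> {a * exp (- r)..a * exp r}" by (auto simp: C cz_cell_def)
    show "emeasure rho (dyadic_cube m k \<times> {a * exp (- r)..a * exp r}) = emeasure rho C"
      unfolding C using ar by (simp add: emeasure_cz_cell emeasure_cz_box)
  qed
qed

section \<open>Subdividing Calderon--Zygmund cells\<close>

text \<open>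
  Halving the interval \<open>[a e\<^sup>-\<^sup>r, a e\<^sup>r)\<close> logarithmically replaces \<open>r\<close> by \<open>r / 2\<close> and \<open>a\<close> by
  \<open>a e\<^sup>\<plusminus>\<^sup>r\<^sup>/\<^sup>2\<close>. This lowers the admissible range for the side \<open>L\<close>, so it can only fail
  because \<open>L\<close> is too large for the lower half; in that case \<open>L / 2\<close> is still admissible for the old
  interval, and the cube can be bisected instead. The constants \<open>2\<close> and \<open>8\<close> in the definition leave
  the room for this alternative.
\<close>

lemma cz_shape_split:
  assumes "cz_shape m a r"
  shows "(cz_shape m (a * exp (- (r / 2))) (r / 2) \<and> cz_shape m (a * exp (r / 2)) (r / 2)) \<or> cz_shape (m - 1) a r"
proof -
  define L :: real where "L = 2 powi m"
  have L2: "2 powi (m - 1) = L / 2" by (simp add: L_def power_int_diff)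
  have ar: "a > 0" "r > 0" using assms by (auto simp: cz_shape_def)
  \<comment> \<open>the condition reads \<open>lo r \<le> L / a < up r\<close>\<close>
  define lo up :: "real \<Rightarrow> real" where "lo = (\<lambda>r. if r < 1 then exp 2 * r else exp (2 * r))"
    and "up = (\<lambda>r. if r < 1 then exp 8 * r else exp (8 * r))"
  have shape: "cz_shape m' a' r' \<longleftrightarrow> a' > 0 \<and> r' > 0 \<and> a' * lo r' \<le> 2 powi m' \<and> 2 powi m' < a' * up r'" for m' a' r'
    by (auto simp: cz_shape_def lo_def up_def mult_ac)
  have L: "a * lo r \<le> L" "L < a * up r" using assms by (auto simp: shape L_def)
  have e: "exp (- (r / 2)) \<le> exp (r / 2)" using ar by simp
  have up_pos: "up (r / 2) > 0" and lo_pos: "lo (r / 2) > 0" using ar by (auto simp: up_def lo_def)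
  \<comment> \<open>the lower bound always survives the halving of the interval\<close>
  have low: "exp (r / 2) * lo (r / 2) \<le> lo r"
  proof -
    consider "r < 1" | "1 \<le> r" "r < 2" | "2 \<le> r" by linarith
    then show ?thesis
    proof cases
      case 1
      have "exp (r / 2) \<le> exp (1 / 2)" using 1 by simp
      also have "\<dots> \<le> (2::real)" by (rule exp_half_le2)
      finally have "exp (r / 2) * (exp 2 * (r / 2)) \<le> 2 * (exp 2 * (r / 2))"
        using ar by (intro mult_right_mono) auto
      then show ?thesis using 1 by (simp add: lo_def)
    next
      case 2
      have "r / 2 \<le> 1 + (3 * r / 2 - 2)" using 2 by simp
      also have "\<dots> \<le> exp (3 * r / 2 - 2)" by (rule exp_ge_add_one_self)
      finally have "exp (2 + r / 2) * (r / 2) \<le> exp (2 + r / 2) * exp (3 * r / 2 - 2)" by (intro mult_left_mono) auto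
      also have "\<dots> = exp (2 * r)" by (simp flip: exp_add)
      finally show ?thesis using 2 by (simp add: lo_def exp_add mult_ac)
    next
      case 3
      have "exp (r / 2) * exp r = exp (3 * r / 2)" by (simp flip: exp_add)
      also have "\<dots> \<le> exp (2 * r)" using ar by simp
      finally show ?thesis using 3 by (simp add: lo_def)
    qed
  qed
  \<comment> \<open>if the upper bound fails for the lower half, the cube can be bisected\<close>
  have gap: "2 * lo r \<le> exp (- (r / 2)) * up (r / 2)"
  proof -
    consider "r < 1" | "1 \<le> r" "r < 2" | "2 \<le> r" by linarith
    then show ?thesis
    proof cases
      case 1
      have "(4::real) \<le> 1 + (6 - r / 2)" using 1 by simp
      also have "\<dots> \<le> exp (6 - r / 2)" by (rule exp_ge_add_one_self)
      finally have "exp 2 * 4 * r \<le> exp 2 * exp (6 - r / 2) * r" using ar by simp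
      also have "exp 2 * exp (6 - r / 2) = exp (- (r / 2)) * exp 8" by (simp flip: exp_add)
      finally show ?thesis using 1 by (simp add: lo_def up_def)
    next
      case 2
      have "(4::real) \<le> 1 + (8 - 5 * r / 2)" using 2 by simp
      also have "\<dots> \<le> exp (8 - 5 * r / 2)" by (rule exp_ge_add_one_self)
      also have "\<dots> \<le> exp (8 - 5 * r / 2) * r" using 2 by simp
      finally have "exp (2 * r) * 4 \<le> exp (2 * r) * (exp (8 - 5 * r / 2) * r)" by simp
      also have "\<dots> = exp (- (r / 2)) * exp 8 * r"
      proof -
        have "exp (2 * r) * exp (8 - 5 * r / 2) = exp (- (r / 2)) * exp 8" by (simp flip: exp_add)
        then show ?thesis by (metis mult.assoc)
      qed
      finally show ?thesis using 2 by (simp add: lo_def up_def)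
    next
      case 3
      have "(2::real) \<le> 1 + (3 * r / 2)" using 3 by simp
      also have "\<dots> \<le> exp (3 * r / 2)" by (rule exp_ge_add_one_self)
      finally have "2 * exp (2 * r) \<le> exp (3 * r / 2) * exp (2 * r)" by (intro mult_right_mono) auto
      also have "\<dots> = exp (- (r / 2)) * exp (4 * r)" by (simp flip: exp_add)
      finally show ?thesis using 3 by (simp add: lo_def up_def)
    qed
  qed
  show ?thesis
  proof (cases "L < a * exp (- (r / 2)) * up (r / 2)")
    case True
    have 1: "a * exp (- (r / 2)) * lo (r / 2) \<le> a * exp (r / 2) * lo (r / 2)"
      using e ar lo_pos by (intro mult_right_mono mult_left_mono) auto
    have 2: "a * exp (r / 2) * lo (r / 2) \<le> L"
    proof -
      have "a * (exp (r / 2) * lo (r / 2)) \<le> a * lo r" using low ar by (intro mult_left_mono) auto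
      then show ?thesis using L by (simp add: mult.assoc)
    qed
    have 3: "a * exp (- (r / 2)) * up (r / 2) \<le> a * exp (r / 2) * up (r / 2)"
      using e ar up_pos by (intro mult_right_mono mult_left_mono) auto
    have "cz_shape m (a * exp (- (r / 2))) (r / 2)"
      unfolding shape L_def[symmetric] using order_trans[OF 1 2] True ar by simp
    moreover have "cz_shape m (a * exp (r / 2)) (r / 2)"
      unfolding shape L_def[symmetric] using less_le_trans[OF True 3] 2 ar by simp
    ultimately show ?thesis by blast
  next
    case False
    have "a * (2 * lo r) \<le> a * (exp (- (r / 2)) * up (r / 2))" using gap ar by (intro mult_left_mono) auto
    also have "\<dots> \<le> L" using False by (simp add: mult.assoc)
    finally have "a * lo r \<le> L / 2" by simp
    moreover have "L / 2 < a * up r"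
    proof -
      have "L > 0" by (simp add: L_def)
      then show ?thesis using L(2) by linarith
    qed
    ultimately show ?thesis using ar unfolding shape L2 by auto
  qed
qed

text \<open>
  The \<open>2\<^sup>d\<close> cubes of half the side in a dyadic cube are indexed by vectors of booleans: a true entry selects the
  upper half in that coordinate.
\<close>

definition dyadic_child :: "int ^ 'n \<Rightarrow> bool ^ 'n \<Rightarrow> int ^ 'n" where
  "dyadic_child k s = (\<chi> i. 2 * k $ i + of_bool (s $ i))"

text \<open>
  The right-hand side exhibits the index of the smaller cube as a function of the point, so these cubes
  partition the large one.
\<close>

lemma dyadic_cube_mem_child:
  "x \<in> dyadic_cube (m - 1) (dyadic_child k s) \<longleftrightarrow>
    x \<in> dyadic_cube m k \<and> s = (\<chi> i. (2 * of_int (k $ i) + 1) * 2 powi (m - 1) \<le> x $ i)"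
proof -
  define l :: real where "l = 2 powi (m - 1)"
  have l: "l > 0" "2 powi m = 2 * l" by (simp_all add: l_def power_int_diff)
  have eq: "of_int (dyadic_child k s $ i) * l \<le> x $ i \<and> x $ i < (of_int (dyadic_child k s $ i) + 1) * l \<longleftrightarrow>
    (of_int (k $ i) * (2 * l) \<le> x $ i \<and> x $ i < (of_int (k $ i) + 1) * (2 * l)) \<and>
    s $ i = ((2 * of_int (k $ i) + 1) * l \<le> x $ i)" for i
    using l(1) by (cases "s $ i") (auto simp: dyadic_child_def algebra_simps)
  show ?thesis
    unfolding dyadic_cube_def l_def[symmetric] l(2) mem_Collect_eq eq vec_eq_iff by auto
qed

text \<open>
  Either the interval or the cube is halved, into \<open>2\<close> or \<open>2\<^sup>d\<close> parts. The parts have equal measure, so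
  the measure bounds amount to \<open>2 \<le> 2\<^sup>d\<close>.
\<close>

lemma cz_cells_split:
  assumes "(C :: ((real^'n) \<times> real) set) \<in> cz_cells"
  shows "\<exists>\<C>\<subseteq>cz_cells. finite \<C> \<and> disjoint \<C> \<and> \<Union>\<C> = C \<and>
      (\<forall>C'\<in>\<C>. emeasure rho C \<le> ennreal (2 ^ CARD('n)) * emeasure rho C' \<and> 2 * emeasure rho C' \<le> emeasure rho C)"
proof -
  obtain m k a r where 1: "cz_shape m a r" and C: "C = cz_cell m k a r"
    using assms unfolding cz_cells_def by blast
  have ar: "a > 0" "r > 0" using 1 by (auto simp: cz_shape_def)
  have two: "(2::ennreal) = ennreal 2" by simp
  have "1 \<le> CARD('n)" by (simp add: Suc_leI)
  then have card: "(2::real) \<le> 2 ^ CARD('n)" using power_increasing[of 1 "CARD('n)" "2::real"] by simp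
  consider (interval) "cz_shape m (a * exp (- (r / 2))) (r / 2)" "cz_shape m (a * exp (r / 2)) (r / 2)"
    | (cube) "cz_shape (m - 1) a r" using cz_shape_split[OF 1] by blast
  then show ?thesis
  proof cases
    case interval
    have e: "exp (- (r / 2)) * exp (- (r / 2)) = exp (- r)" "exp (- (r / 2)) * exp (r / 2) = (1::real)"
      "exp (r / 2) * exp (- (r / 2)) = (1::real)" "exp (r / 2) * exp (r / 2) = exp r" by (simp_all flip: exp_add)
    let ?A = "cz_cell m k (a * exp (- (r / 2))) (r / 2)" and ?B = "cz_cell m k (a * exp (r / 2)) (r / 2)"
    have A: "?A = dyadic_cube m k \<times> {a * exp (- r)..<a}" and B: "?B = dyadic_cube m k \<times> {a..<a * exp r}"
      by (simp_all add: cz_cell_def mult.assoc e)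
    have "a * exp (- r) \<le> a" "a \<le> a * exp r" using ar by simp_all
    then have un: "\<Union>{?A, ?B} = C" unfolding Union_insert Union_empty A B unfolding C cz_cell_def by auto
    have AB: "?A \<inter> ?B = {}" unfolding A B by auto
    have m: "emeasure rho ?A = ennreal (r * (2 powi m) ^ CARD('n))" "emeasure rho ?B = ennreal (r * (2 powi m) ^ CARD('n))"
      "emeasure rho C = ennreal (2 * r * (2 powi m) ^ CARD('n))"
      unfolding C using ar by (simp_all add: emeasure_cz_cell)
    have le: "2 * (r * (2 powi m) ^ CARD('n)) \<le> 2 ^ CARD('n) * (r * (2 powi m) ^ CARD('n))"
      using card ar by (intro mult_right_mono) auto
    show ?thesis
    proof (intro exI[of _ "{?A, ?B}"] conjI ballI)
      show "{?A, ?B} \<subseteq> cz_cells" using interval by (auto simp: cz_cells_def)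
      show "disjoint {?A, ?B}" using AB by (auto simp: disjoint_def)
      show "\<Union>{?A, ?B} = C" by (fact un)
      fix C' assume "C' \<in> {?A, ?B}"
      then have C': "emeasure rho C' = ennreal (r * (2 powi m) ^ CARD('n))" using m by auto
      show "emeasure rho C \<le> ennreal (2 ^ CARD('n)) * emeasure rho C'"
        unfolding C' m(3) using le ar by (simp add: mult.assoc flip: ennreal_mult)
      show "2 * emeasure rho C' \<le> emeasure rho C"
        unfolding C' m(3) two using ar by (simp add: mult.assoc flip: ennreal_mult del: ennreal_numeral)
    qed simp
  next
    case cube
    define F where "F s = cz_cell (m - 1) (dyadic_child k s) a r" for s
    have memF: "z \<in> F s \<longleftrightarrow> z \<in> C \<and> s = (\<chi> i. (2 * of_int (k $ i) + 1) * 2 powi (m - 1) \<le> fst z $ i)" for z s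
      unfolding F_def C cz_cell_def mem_Times_iff dyadic_cube_mem_child by blast
    have vol: "2 * r * (2 powi m) ^ CARD('n) = 2 ^ CARD('n) * (2 * r * (2 powi (m - 1)) ^ CARD('n) :: real)"
    proof -
      have "(2 powi m :: real) = 2 * 2 powi (m - 1)" by (simp add: power_int_diff)
      then show ?thesis by (simp add: power_mult_distrib)
    qed
    let ?v = "2 * r * (2 powi (m - 1)) ^ CARD('n)"
    have v: "?v \<ge> 0" using ar by simp
    show ?thesis
    proof (intro exI[of _ "range F"] conjI ballI)
      show "range F \<subseteq> cz_cells" using cube by (auto simp: F_def cz_cells_def)
      show "disjoint (range F)"
      proof (unfold disjoint_def, intro ballI impI)
        fix A B assume "A \<in> range F" "B \<in> range F" "A \<noteq> B"
        then obtain s s' where "A = F s" "B = F s'" "s \<noteq> s'" by blast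
        then show "A \<inter> B = {}" by (auto simp: memF)
      qed
      show "\<Union>(range F) = C" by (auto simp: memF)
      fix C' assume "C' \<in> range F"
      then have C': "emeasure rho C' = ennreal ?v" using ar by (auto simp: F_def emeasure_cz_cell)
      have m: "emeasure rho C = ennreal (2 ^ CARD('n) * ?v)"
        unfolding C using ar vol by (simp add: emeasure_cz_cell)
      show "emeasure rho C \<le> ennreal (2 ^ CARD('n)) * emeasure rho C'"
        unfolding C' m by (subst ennreal_mult[symmetric]) (use v in auto)
      have "2 * ?v \<le> 2 ^ CARD('n) * ?v" using card v by (intro mult_right_mono) auto
      then show "2 * emeasure rho C' \<le> emeasure rho C"
        unfolding C' m two by (subst ennreal_mult[symmetric]) (use v in \<open>auto intro: ennreal_leI\<close>)
    qed simp
  qed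
qed

lemma dyadic_cube_dist:
  fixes x y :: "real^'n"
  assumes "x \<in> dyadic_cube m k" "y \<in> dyadic_cube m k"
  shows "dist x y \<le> CARD('n) * 2 powi m"
proof -
  have "\<bar>(x - y) $ i\<bar> \<le> 2 powi m" for i
  proof -
    have "of_int (k $ i) * 2 powi m \<le> x $ i" "x $ i < (of_int (k $ i) + 1) * 2 powi m"
      "of_int (k $ i) * 2 powi m \<le> y $ i" "y $ i < (of_int (k $ i) + 1) * 2 powi m"
      using assms unfolding dyadic_cube_def by blast+
    then show ?thesis by (simp add: algebra_simps abs_le_iff)
  qed
  then have "(\<Sum>i\<in>UNIV. \<bar>(x - y) $ i\<bar>) \<le> CARD('n) * 2 powi m"
    using sum_bounded_above[of "UNIV :: 'n set" "\<lambda>i. \<bar>(x - y) $ i\<bar>" "2 powi m"] by simp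
  then show ?thesis using norm_le_l1_cart[of "x - y"] by (simp add: dist_norm)
qed

text \<open>
  Inside \<open>R\<close> the parameter \<open>a\<close> stays between positive bounds \<open>l\<close> and \<open>u\<close>, and the shape condition
  gives \<open>L \<ge> l r\<close>. Hence the measure \<open>2 r L\<^sup>d\<close> controls \<open>r\<close>, and once \<open>r < 1\<close> also
  \<open>L < e\<^sup>8 u r\<close> is small.
\<close>

lemma cz_cells_shrink:
  assumes R: "(R :: ((real^'n) \<times> real) set) \<in> cz_cells" and e: "e > (0::real)"
  shows "\<exists>\<delta>::real>0. \<forall>C\<in>cz_cells. C \<subseteq> R \<longrightarrow> emeasure rho C < ennreal \<delta> \<longrightarrow>
      (\<forall>x\<in>C. \<forall>y\<in>C. dist x y < e)"
proof -
  obtain m0 k0 a0 r0 where R0: "R = cz_cell m0 k0 a0 r0" and 0: "a0 > 0" "r0 > 0"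
    using R unfolding cz_cells_def cz_shape_def by blast
  define l u where "l = a0 * exp (- r0)" and "u = a0 * exp r0"
  have lu: "l > 0" "u > 0" using 0 by (simp_all add: l_def u_def)
  define K where "K = CARD('n) * (exp 8 * u) + 4 * u"
  have K: "K > 0" using lu by (simp add: K_def add_nonneg_pos)
  define h where "h = min 1 (e / K)"
  have h: "h > 0" "h \<le> 1" "K * h \<le> e" using e K by (auto simp: h_def min_def field_simps)
  define \<delta> where "\<delta> = 2 * h * (l * h) ^ CARD('n)"
  show ?thesis
  proof (intro exI[of _ \<delta>] conjI ballI impI)
    show "\<delta> > 0" using h lu by (simp add: \<delta>_def)
    fix C x y assume C: "C \<in> cz_cells" "C \<subseteq> R" "emeasure rho C < ennreal \<delta>" and xy: "x \<in> C" "y \<in> C"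
    obtain m k a r where 1: "cz_shape m a r" and Ceq: "C = cz_cell m k a r"
      using C(1) unfolding cz_cells_def by blast
    have ar: "a > 0" "r > 0" using 1 by (auto simp: cz_shape_def)
    obtain q :: "real^'n" where q: "q \<in> dyadic_cube m k" using dyadic_cube_nonempty by blast
    have "a * exp (- r) \<le> a" "a < a * exp r" "a * exp (- r) < a * exp r" using ar by simp_all
    then have "(q, a) \<in> C" using q by (simp add: Ceq cz_cell_def)
    then have a: "l \<le> a" "a < u" using C(2) by (auto simp: R0 cz_cell_def l_def u_def)
    have Ll: "l * r \<le> 2 powi m"
    proof (cases "r < 1")
      case True
      have "a \<le> exp 2 * a" using ar by simp
      then have "l \<le> exp 2 * a" using a(1) by linarith
      then have "l * r \<le> exp 2 * a * r" using ar by (intro mult_right_mono) auto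
      also have "\<dots> \<le> 2 powi m" using 1 True by (simp add: cz_shape_def)
      finally show ?thesis .
    next
      case False
      have "r \<le> 1 + 2 * r" using ar by simp
      also have "\<dots> \<le> exp (2 * r)" by (rule exp_ge_add_one_self)
      finally have "l * r \<le> a * exp (2 * r)" using a ar lu by (intro mult_mono) auto
      then show ?thesis using 1 False by (simp add: cz_shape_def)
    qed
    have rh: "r < h"
    proof (rule ccontr)
      assume "\<not> ?thesis"
      then have hr: "h \<le> r" by simp
      have "(l * h) ^ CARD('n) \<le> (2 powi m) ^ CARD('n)"
        using hr lu h Ll by (intro power_mono order_trans[OF _ Ll]) auto
      then have "\<delta> \<le> 2 * r * (2 powi m) ^ CARD('n)"
        unfolding \<delta>_def using hr lu h by (intro mult_mono) auto
      then show False using C(3) ar unfolding Ceq by (simp add: emeasure_cz_cell ennreal_less_iff)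
    qed
    then have r1: "r < 1" using h by simp
    have "2 powi m < exp 8 * a * r" using 1 r1 by (simp add: cz_shape_def)
    also have "\<dots> \<le> exp 8 * u * h" using a rh ar h lu by (intro mult_mono) auto
    finally have Lu: "2 powi m \<le> exp 8 * u * h" by simp
    have x: "fst x \<in> dyadic_cube m k" "fst y \<in> dyadic_cube m k"
      "a * exp (- r) \<le> snd x" "snd x < a * exp r" "a * exp (- r) \<le> snd y" "snd y < a * exp r"
      using xy by (auto simp: Ceq cz_cell_def)
    have er: "exp r - exp (- r) \<le> 4 * r"
    proof -
      have "exp r * (1 - r) \<le> exp r * exp (- r)"
        using exp_ge_add_one_self[of "- r"] by (intro mult_left_mono) auto
      then have "exp r \<le> 1 + r * exp r" by (simp add: algebra_simps flip: exp_add)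
      moreover have "exp r \<le> 3" using r1 exp_le by (meson exp_le_cancel_iff less_imp_le order_trans)
      then have "r * exp r \<le> r * 3" using ar by (intro mult_left_mono) auto
      ultimately show ?thesis using exp_ge_add_one_self[of "- r"] by simp
    qed
    have "\<bar>snd x - snd y\<bar> < a * (exp r - exp (- r))" using x by (simp add: abs_less_iff algebra_simps)
    also have "\<dots> \<le> u * (4 * h)" using a er rh ar lu by (intro mult_mono) auto
    finally have 2: "dist (snd x) (snd y) < u * (4 * h)" by (simp add: dist_real_def)
    have "dist (fst x) (fst y) \<le> CARD('n) * 2 powi m" by (rule dyadic_cube_dist[OF x(1,2)])
    also have "\<dots> \<le> CARD('n) * (exp 8 * u * h)" using Lu by (intro mult_left_mono) auto
    finally have 3: "dist (fst x) (fst y) \<le> CARD('n) * (exp 8 * u * h)" .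
    have "dist x y \<le> dist (fst x) (fst y) + dist (snd x) (snd y)"
      unfolding dist_prod_def by (rule sqrt_sum_squares_le_sum) auto
    also have "\<dots> < K * h" using 2 3 by (simp add: K_def algebra_simps)
    also have "\<dots> \<le> e" by (rule h)
    finally show "dist x y < e" .
  qed
qed

section \<open>Atoms\<close>

text \<open>
  Integrated over a set, this bounds the \<open>L\<^sup>1\<close> norm by the measure and the integral of the
  \<open>q\<close>-th power; with a suitable \<open>s\<close> it does the work of Hoelder's inequality up to a constant.
\<close>

lemma truncation_bound:
  fixes x s q :: real
  assumes "0 \<le> x" "0 < s" "1 \<le> q"
  shows "x \<le> s + s powr (1 - q) * x powr q"
proof (cases "x \<le> s")
  case True
  then show ?thesis using assms by (simp add: add_increasing2)
next
  case False
  then have "x powr (1 - q) \<le> s powr (1 - q)" using assms by (intro powr_mono2') auto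
  then have "x powr (1 - q) * x powr q \<le> s powr (1 - q) * x powr q" by (intro mult_right_mono) auto
  also have "x powr (1 - q) * x powr q = x" using False assms by (simp flip: powr_add)
  finally show ?thesis using assms by simp
qed

lemma powr_add_le:
  fixes x y q :: real
  assumes "0 \<le> x" "0 \<le> y" "0 \<le> q"
  shows "(x + y) powr q \<le> 2 powr q * (x powr q + y powr q)"
proof -
  have "(x + y) powr q \<le> (2 * max x y) powr q" using assms by (intro powr_mono2) auto
  also have "\<dots> = 2 powr q * (max x y) powr q" by (simp add: powr_mult)
  also have "(max x y) powr q \<le> x powr q + y powr q" by (simp add: max_def)
  finally show ?thesis by simp
qed

lemma cz_cell_measure:
  assumes "C \<in> cz_cells"
  shows "C \<in> sets rho" "emeasure rho C = ennreal (measure rho C)" "measure rho C > 0"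
proof -
  show "C \<in> sets rho" using assms by (rule cz_cells_sets)
  show *: "emeasure rho C = ennreal (measure rho C)"
    using emeasure_cz_cells[OF assms] by (intro emeasure_eq_ennreal_measure) auto
  show "measure rho C > 0" using emeasure_cz_cells[OF assms] unfolding * by simp
qed

text \<open>
  Supports are only specified almost everywhere, so closed sets and half-open cells give the same
  atoms.
\<close>

lemma atom_iff_cell:
  fixes f :: "(real^'n) \<times> real \<Rightarrow> complex"
  shows "atom p f \<longleftrightarrow> (\<exists>C\<in>cz_cells. f \<in> borel_measurable rho \<and> (AE z in rho. z \<notin> C \<longrightarrow> f z = 0) \<and>
    Lp_norm rho p f \<le> ennreal (measure rho C powr (enn2real (1 / p) - 1)) \<and> has_bochner_integral rho f 0)"
    (is "_ \<longleftrightarrow> ?rhs")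
proof
  assume "atom p f"
  then obtain R where R: "cz_set R" "f \<in> borel_measurable rho" "AE z in rho. z \<notin> R \<longrightarrow> f z = 0"
    "Lp_norm rho p f \<le> ennreal (measure rho R powr (enn2real (1 / p) - 1))" "has_bochner_integral rho f 0"
    unfolding atom_def by blast
  obtain C where C: "C \<in> cz_cells" "C \<subseteq> R" "emeasure rho C = emeasure rho R" "AE z in rho. z \<in> R \<longrightarrow> z \<in> C"
    using cz_set_cell[OF R(1)] .
  have "measure rho C = measure rho R" using C(3) by (simp add: measure_def)
  moreover have "AE z in rho. z \<notin> C \<longrightarrow> f z = 0" using R(3) C(4) by eventually_elim auto
  ultimately show ?rhs using R C(1) by (intro bexI[of _ C]) auto
next
  assume ?rhs
  then obtain C where C: "C \<in> cz_cells" "f \<in> borel_measurable rho" "AE z in rho. z \<notin> C \<longrightarrow> f z = 0"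
    "Lp_norm rho p f \<le> ennreal (measure rho C powr (enn2real (1 / p) - 1))" "has_bochner_integral rho f 0"
    by blast
  obtain R where R: "cz_set R" "C \<subseteq> R" "emeasure rho R = emeasure rho C" using cell_cz_set[OF C(1)] .
  have "measure rho C = measure rho R" using R(3) by (simp add: measure_def)
  moreover have "AE z in rho. z \<notin> R \<longrightarrow> f z = 0" using C(3) by eventually_elim (use R(2) in auto)
  ultimately show "atom p f" unfolding atom_def using C R(1) by (intro exI[of _ R]) auto
qed

lemma Lp_norm_le_iff:
  assumes q: "q > 0" and A: "A \<ge> 0" and f: "f \<in> borel_measurable M"
  shows "Lp_norm M (ennreal q) f \<le> ennreal A \<longleftrightarrow> (\<integral>\<^sup>+z. ennreal (norm (f z) powr q) \<partial>M) \<le> ennreal (A powr q)"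
proof (cases "integrable M (\<lambda>z. norm (f z) powr q)")
  case True
  define I where "I = (LINT z|M. norm (f z) powr q)"
  have I: "I \<ge> 0" unfolding I_def by simp
  have "(\<integral>\<^sup>+z. ennreal (norm (f z) powr q) \<partial>M) = ennreal I"
    unfolding I_def using True by (intro nn_integral_eq_integral) auto
  moreover have "Lp_norm M (ennreal q) f = ennreal (I powr (1 / q))"
    using True q by (simp add: Lp_norm_def I_def)
  moreover have "I powr (1 / q) \<le> A \<longleftrightarrow> I \<le> A powr q"
  proof
    assume "I powr (1 / q) \<le> A"
    then have "(I powr (1 / q)) powr q \<le> A powr q" using q by (intro powr_mono2) auto
    then show "I \<le> A powr q" using q I by (simp add: powr_powr)
  next
    assume "I \<le> A powr q"
    then have "I powr (1 / q) \<le> (A powr q) powr (1 / q)" using q I by (intro powr_mono2) auto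
    then show "I powr (1 / q) \<le> A" using q A by (simp add: powr_powr)
  qed
  ultimately show ?thesis using A by (simp add: ennreal_le_iff)
next
  case False
  have "\<not> (\<integral>\<^sup>+z. ennreal (norm (f z) powr q) \<partial>M) \<le> ennreal (A powr q)"
  proof
    assume "(\<integral>\<^sup>+z. ennreal (norm (f z) powr q) \<partial>M) \<le> ennreal (A powr q)"
    then have "(\<integral>\<^sup>+z. ennreal (norm (norm (f z) powr q)) \<partial>M) < \<infinity>"
      by (simp add: order_le_less_trans[OF _ ennreal_less_top])
    then show False using False f by (auto intro!: integrableI_bounded)
  qed
  then show ?thesis using False q by (simp add: Lp_norm_def top_unique)
qed

lemma atom_iff:
  fixes f :: "(real^'n) \<times> real \<Rightarrow> complex"
  assumes q: "q > 1"
  shows "atom (ennreal q) f \<longleftrightarrow> (\<exists>C\<in>cz_cells. f \<in> borel_measurable rho \<and> (AE z in rho. z \<notin> C \<longrightarrow> f z = 0) \<and>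
    (\<integral>\<^sup>+z. ennreal (norm (f z) powr q) \<partial>rho) \<le> ennreal (measure rho C powr (1 - q)) \<and> has_bochner_integral rho f 0)"
proof -
  have "1 / ennreal q = ennreal (1 / q)" using q divide_ennreal[of 1 q] by simp
  then have e: "enn2real (1 / ennreal q) = 1 / q" using q by simp
  have p: "(V powr (1 / q - 1)) powr q = V powr (1 - q)" for V :: real
    using q by (simp add: powr_powr left_diff_distrib)
  show ?thesis
    unfolding atom_iff_cell e
    by (intro bex_cong refl conj_cong) (use q in \<open>simp add: Lp_norm_le_iff p\<close>)
qed

lemma atom_top_iff:
  fixes f :: "(real^'n) \<times> real \<Rightarrow> complex"
  shows "atom \<infinity> f \<longleftrightarrow> (\<exists>C\<in>cz_cells. f \<in> borel_measurable rho \<and> (AE z in rho. z \<notin> C \<longrightarrow> f z = 0) \<and>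
    (AE z in rho. norm (f z) \<le> 1 / measure rho C) \<and> has_bochner_integral rho f 0)"
proof -
  have "Lp_norm rho \<infinity> f \<le> ennreal (V powr (enn2real (1 / \<infinity>) - 1)) \<longleftrightarrow> (AE z in rho. norm (f z) \<le> 1 / V)"
    if f: "f \<in> borel_measurable rho" and V: "V > 0" for V
  proof -
    have 1: "V powr (enn2real (1 / \<infinity>) - 1) = 1 / V" using V by (simp add: powr_minus_divide)
    have "esssup rho (\<lambda>z. ennreal (norm (f z))) \<le> ennreal (1 / V) \<longleftrightarrow> (AE z in rho. ennreal (norm (f z)) \<le> ennreal (1 / V))"
    proof
      assume le: "esssup rho (\<lambda>z. ennreal (norm (f z))) \<le> ennreal (1 / V)"
      show "AE z in rho. ennreal (norm (f z)) \<le> ennreal (1 / V)"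
        using esssup_AE[of "\<lambda>z. ennreal (norm (f z))" rho] by eventually_elim (rule order_trans[OF _ le])
    qed (use f in \<open>auto intro!: esssup_I\<close>)
    then show ?thesis using V unfolding 1 by (simp add: Lp_norm_def ennreal_le_iff)
  qed
  then show ?thesis
    unfolding atom_iff_cell by (intro bex_cong refl conj_cong) (auto simp: cz_cell_measure(3))
qed

lemma atom_top_imp_atom:
  assumes "atom \<infinity> f" "q > 1"
  shows "atom (ennreal q) f"
proof -
  obtain C where C: "C \<in> cz_cells" "f \<in> borel_measurable rho" "AE z in rho. z \<notin> C \<longrightarrow> f z = 0"
    "AE z in rho. norm (f z) \<le> 1 / measure rho C" "has_bochner_integral rho f 0"
    using assms(1) unfolding atom_top_iff by blast
  define V where "V = measure rho C"
  have V: "V > 0" "emeasure rho C = ennreal V" "C \<in> sets rho" using cz_cell_measure[OF C(1)] by (auto simp: V_def)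
  have "(\<integral>\<^sup>+z. ennreal (norm (f z) powr q) \<partial>rho) \<le> (\<integral>\<^sup>+z. ennreal ((1 / V) powr q) * indicator C z \<partial>rho)"
  proof (intro nn_integral_mono_AE)
    show "AE z in rho. ennreal (norm (f z) powr q) \<le> ennreal ((1 / V) powr q) * indicator C z"
      using C(3,4)
    proof eventually_elim
      case (elim z)
      then show ?case using assms(2) by (auto simp: V_def split: split_indicator intro!: ennreal_leI powr_mono2)
    qed
  qed
  also have "\<dots> = ennreal ((1 / V) powr q) * ennreal V"
    using V by (simp add: nn_integral_cmult_indicator)
  also have "\<dots> = ennreal (V powr (1 - q))"
    using V by (simp add: powr_diff powr_divide flip: ennreal_mult)
  finally show ?thesis unfolding atom_iff[OF assms(2)] V_def using C by blast
qed

text \<open>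
  The constant is \<open>2\<close> instead of \<open>1\<close> because the truncation level \<open>s = 1 / \<rho>(C)\<close> is used in place of
  Hoelder's inequality; only a bound independent of the atom matters.
\<close>

lemma atom_L1_bound:
  assumes "atom (ennreal q) f" "q > 1"
  shows "(\<integral>\<^sup>+z. ennreal (norm (f z)) \<partial>rho) \<le> 2"
proof -
  obtain C where C: "C \<in> cz_cells" "f \<in> borel_measurable rho" "AE z in rho. z \<notin> C \<longrightarrow> f z = 0"
    "(\<integral>\<^sup>+z. ennreal (norm (f z) powr q) \<partial>rho) \<le> ennreal (measure rho C powr (1 - q))"
    using assms(1) unfolding atom_iff[OF assms(2)] by blast
  note [measurable] = C(2)
  define V where "V = measure rho C"
  have V: "V > 0" "emeasure rho C = ennreal V" "C \<in> sets rho" using cz_cell_measure[OF C(1)] by (auto simp: V_def)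
  note [measurable] = V(3)
  define k where "k = (1 / V) powr (1 - q)"
  have "(\<integral>\<^sup>+z. ennreal (norm (f z)) \<partial>rho) \<le>
    (\<integral>\<^sup>+z. ennreal (1 / V) * indicator C z + ennreal k * ennreal (norm (f z) powr q) \<partial>rho)"
  proof (intro nn_integral_mono_AE)
    show "AE z in rho. ennreal (norm (f z)) \<le> ennreal (1 / V) * indicator C z + ennreal k * ennreal (norm (f z) powr q)"
      using C(3)
    proof eventually_elim
      case (elim z)
      have "norm (f z) \<le> 1 / V + k * norm (f z) powr q"
        unfolding k_def using V assms by (intro truncation_bound) auto
      then have "ennreal (norm (f z)) \<le> ennreal (1 / V + k * norm (f z) powr q)" by (rule ennreal_leI)
      also have "\<dots> = ennreal (1 / V) + ennreal k * ennreal (norm (f z) powr q)"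
        using V by (simp add: k_def ennreal_mult ennreal_plus)
      finally show ?case using elim by (auto split: split_indicator)
    qed
  qed
  also have "\<dots> = ennreal (1 / V) * emeasure rho C + ennreal k * (\<integral>\<^sup>+z. ennreal (norm (f z) powr q) \<partial>rho)"
    by (subst nn_integral_add) (auto simp: nn_integral_cmult nn_integral_cmult_indicator)
  also have "\<dots> \<le> ennreal (1 / V) * ennreal V + ennreal k * ennreal (V powr (1 - q))"
    using C(4) V by (intro add_mono mult_left_mono) (auto simp: V_def)
  also have "\<dots> = 2"
  proof -
    have "k * V powr (1 - q) = 1" using V by (simp add: k_def flip: powr_mult)
    moreover have "1 / V * V = 1" using V by simp
    ultimately show ?thesis using V by (simp add: k_def flip: ennreal_mult)
  qed
  finally show ?thesis .
qed

lemma atom_zero: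
  assumes "(C :: ((real^'n) \<times> real) set) \<in> cz_cells" "q > 1"
  shows "atom (ennreal q) (\<lambda>_ :: (real^'n) \<times> real. 0)"
  unfolding atom_iff[OF assms(2)] using assms by (intro bexI[of _ C]) auto

text \<open>
  Atomic decompositions with total coefficient at most \<open>N\<close>, with convergence almost everywhere
  in place of convergence in \<open>L\<^sup>1\<close>. For integrable \<open>h\<close> the two agree (\<open>atomic_decomp_iff\<close>), and
  pointwise convergence is easier to regroup.
\<close>

definition atomic_sum :: "ennreal \<Rightarrow> real \<Rightarrow> ((real ^ 'n) \<times> real \<Rightarrow> complex) \<Rightarrow> bool" where
  "atomic_sum p N h \<longleftrightarrow> (\<exists>c A. (\<forall>j. atom p (A j)) \<and> summable (\<lambda>j. norm (c j)) \<and> (\<Sum>j. norm (c j)) \<le> N \<and>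
     (AE z in rho. (\<lambda>j. c j * A j z) sums h z))"

section \<open>Calderon--Zygmund decomposition of an atom\<close>

text \<open>
  The covering lemma for \<open>\<rho>\<close> and \<open>w d\<rho>\<close>. The stopped cells are listed as a sequence, which is padded
  with empty sets because there may be finitely many or none.
\<close>

lemma cz_covering_rho:
  fixes w :: "(real^'n) \<times> real \<Rightarrow> real"
  assumes C: "C \<in> cz_cells" and w: "w \<in> borel_measurable rho" and t: "t \<ge> 0"
    and avg: "(\<integral>\<^sup>+z. ennreal (w z) \<partial>rho) \<le> ennreal (t * measure rho C)"
  obtains e :: "nat \<Rightarrow> ((real^'n) \<times> real) set" where
    "\<And>i. e i = {} \<or> e i \<in> cz_cells" "disjoint_family e" "\<And>i. e i \<subseteq> C"
    "\<And>i. ennreal (t * measure rho (e i)) \<le> (\<integral>\<^sup>+z. ennreal (w z) * indicator (e i) z \<partial>rho)"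
    "\<And>i. (\<integral>\<^sup>+z. ennreal (w z) * indicator (e i) z \<partial>rho) \<le> ennreal (t * (2 ^ CARD('n) * measure rho (e i)))"
    "AE z in rho. z \<in> C - (\<Union>i. e i) \<longrightarrow> w z \<le> t"
proof -
  note [measurable] = w
  define N where "N = density rho (\<lambda>z. ennreal (w z))"
  have N: "emeasure N A = (\<integral>\<^sup>+z. ennreal (w z) * indicator A z \<partial>rho)" if "A \<in> sets rho" for A
    unfolding N_def using that by (intro emeasure_density) auto
  have setsN: "sets N = sets rho" by (simp add: N_def)
  note Cm = cz_cell_measure[OF C]
  have avg': "emeasure N C \<le> ennreal t * emeasure rho C"
  proof -
    have "emeasure N C \<le> (\<integral>\<^sup>+z. ennreal (w z) \<partial>rho)"
      unfolding N[OF Cm(1)] by (intro nn_integral_mono) (auto split: split_indicator)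
    also have "\<dots> \<le> ennreal t * emeasure rho C" using avg t Cm(3) unfolding Cm(2) by (simp flip: ennreal_mult)
    finally show ?thesis .
  qed
  have sub: "sets (rho :: ((real^'n) \<times> real) measure) \<subseteq> sets borel" by (auto simp: sets_rho)
  obtain \<B> where B: "\<B> \<subseteq> cz_cells" "countable \<B>" "disjoint \<B>"
    "\<And>B. B \<in> \<B> \<Longrightarrow> B \<subseteq> C"
    "\<And>B. B \<in> \<B> \<Longrightarrow> ennreal t * emeasure rho B \<le> emeasure N B"
    "\<And>B. B \<in> \<B> \<Longrightarrow> emeasure N B \<le> ennreal t * (ennreal (2 ^ CARD('n)) * emeasure rho B)"
    "\<And>E. E \<in> sets rho \<Longrightarrow> E \<subseteq> C - \<Union>\<B> \<Longrightarrow> emeasure N E \<le> ennreal t * emeasure rho E"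
  proof (rule calderon_zygmund_covering[where M = rho and N = N and \<D> = cz_cells and R = C and t = "ennreal t" and D = "ennreal (2 ^ CARD('n))"])
    show "\<exists>\<C>\<subseteq>cz_cells. finite \<C> \<and> disjoint \<C> \<and> \<Union>\<C> = X \<and>
      (\<forall>C'\<in>\<C>. emeasure rho X \<le> ennreal (2 ^ CARD('n)) * emeasure rho C' \<and> 2 * emeasure rho C' \<le> emeasure rho X)"
      if "X \<in> cz_cells" for X :: "((real^'n) \<times> real) set" using that by (rule cz_cells_split)
    show "\<exists>\<delta>::real>0. \<forall>X\<in>cz_cells. X \<subseteq> C \<longrightarrow> emeasure rho X < ennreal \<delta> \<longrightarrow> (\<forall>x\<in>X. \<forall>y\<in>X. dist x y < e)"
      if "e > 0" for e :: real using C that by (rule cz_cells_shrink)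
  qed (use C Cm avg' id_rho_borel sub cz_cells_sets setsN in auto)
  \<comment> \<open>the indices that enumerate no cell are the ones padded with the empty set\<close>
  define e where "e i = (if i \<in> to_nat_on \<B> ` \<B> then from_nat_into \<B> i else {})" for i
  have e_in: "e i = {} \<or> e i \<in> \<B>" for i
    using from_nat_into_to_nat_on[OF B(2)] by (auto simp: e_def)
  have e_to: "e (to_nat_on \<B> X) = X" if "X \<in> \<B>" for X
    using that B(2) by (simp add: e_def)
  have Ue: "(\<Union>i. e i) = \<Union>\<B>" using e_in e_to by blast
  have disj: "disjoint_family e"
    unfolding disjoint_family_on_def
  proof (intro ballI impI)
    fix i j :: nat assume "i \<noteq> j"
    show "e i \<inter> e j = {}"
    proof (cases "i \<in> to_nat_on \<B> ` \<B> \<and> j \<in> to_nat_on \<B> ` \<B>")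
      case True
      then obtain X Y where XY: "X \<in> \<B>" "Y \<in> \<B>" "i = to_nat_on \<B> X" "j = to_nat_on \<B> Y" by blast
      then have "X \<noteq> Y" using \<open>i \<noteq> j\<close> by blast
      then show ?thesis using B(3) XY e_to by (simp add: disjoint_def)
    qed (auto simp: e_def)
  qed
  have e_meas: "e i \<in> sets rho" for i using e_in[of i] B(1) cz_cells_sets by auto
  have e_em: "emeasure rho (e i) = ennreal (measure rho (e i))" for i
    using e_in[of i] B(1) cz_cell_measure(2) by auto
  show ?thesis
  proof (rule that[of e])
    show "e i = {} \<or> e i \<in> cz_cells" for i using e_in[of i] B(1) by blast
    show "disjoint_family e" by (rule disj)
    show "e i \<subseteq> C" for i using e_in[of i] B(4) by blast
    have low: "ennreal t * emeasure rho (e i) \<le> emeasure N (e i)" for i using e_in[of i] B(5) by auto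
    show "ennreal (t * measure rho (e i)) \<le> (\<integral>\<^sup>+z. ennreal (w z) * indicator (e i) z \<partial>rho)" for i
      using low[of i] t unfolding e_em N[OF e_meas] by (simp add: ennreal_mult)
    have up: "emeasure N (e i) \<le> ennreal t * (ennreal (2 ^ CARD('n)) * emeasure rho (e i))" for i
      using e_in[of i] B(6) by auto
    show "(\<integral>\<^sup>+z. ennreal (w z) * indicator (e i) z \<partial>rho) \<le> ennreal (t * (2 ^ CARD('n) * measure rho (e i)))" for i
      using up[of i] t unfolding e_em N[OF e_meas] by (simp add: ennreal_mult)
    define E where "E = (C - (\<Union>i. e i)) \<inter> {z \<in> space rho. t < w z}"
    have Em: "E \<in> sets rho"
      unfolding E_def using Cm(1) e_meas by (intro sets.Int sets.Diff sets.countable_UN) auto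
    have Ew: "t \<le> w z" if "z \<in> E" for z using that by (auto simp: E_def)
    note [measurable] = Em
    have "emeasure N E \<le> ennreal t * emeasure rho E" using Em by (intro B(7)) (auto simp: E_def Ue)
    then have le: "(\<integral>\<^sup>+z. ennreal (w z) * indicator E z \<partial>rho) \<le> (\<integral>\<^sup>+z. ennreal t * indicator E z \<partial>rho)"
      using Em N by (simp add: nn_integral_cmult_indicator)
    have fin: "(\<integral>\<^sup>+z. ennreal t * indicator E z \<partial>rho) \<noteq> \<infinity>"
    proof -
      have "emeasure rho E \<le> emeasure rho C" using Cm(1) by (intro emeasure_mono) (auto simp: E_def)
      then have "emeasure rho E < \<infinity>" unfolding Cm(2) by (simp add: order_le_less_trans[OF _ ennreal_less_top])
      then show ?thesis using Em by (simp add: nn_integral_cmult_indicator ennreal_mult_eq_top_iff)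
    qed
    have "AE z in rho. ennreal (w z) * indicator E z \<le> ennreal t * indicator E z"
    proof (rule ccontr)
      assume "\<not> ?thesis"
      then have "(\<integral>\<^sup>+z. ennreal t * indicator E z \<partial>rho) < (\<integral>\<^sup>+z. ennreal (w z) * indicator E z \<partial>rho)"
        using fin by (intro nn_integral_less) (auto simp: Ew split: split_indicator intro!: ennreal_leI)
      then show False using le by simp
    qed
    then show "AE z in rho. z \<in> C - (\<Union>i. e i) \<longrightarrow> w z \<le> t"
      using AE_space
    proof eventually_elim
      case (elim z)
      then show ?case using t by (cases "z \<in> E") (auto simp: E_def ennreal_le_iff)
    qed
  qed
qed

text \<open>
  The Calderon--Zygmund decomposition of one atom. With \<open>s = \<alpha> / \<rho>(C)\<close>, stop at the cells on which
  the average of \<open>|f|\<^sup>q\<close> exceeds \<open>s\<^sup>q\<close>. Replacing \<open>f\<close> by its average on each stopped cell yields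
  a bounded function, a multiple \<open>K = (1 + 2\<^sup>d) \<alpha>\<close> of a \<open>(1,\<infinity>)\<close>-atom. What is left on the stopped
  cells are multiples of \<open>(1,q)\<close>-atoms, whose coefficients are of the order of \<open>s \<rho>(B)\<close>; the total
  measure of the stopped cells is at most \<open>\<alpha>\<^sup>-\<^sup>q \<rho>(C)\<close>, so the coefficients sum to a multiple of
  \<open>\<alpha>\<^sup>1\<^sup>-\<^sup>q\<close>. Because \<open>q > 1\<close>, a large \<open>\<alpha>\<close> brings this sum down to \<open>1 / 2\<close>.
\<close>

lemma atom_reduction:
  fixes f :: "(real^'n) \<times> real \<Rightarrow> complex"
  assumes q: "q > 1" and f: "atom (ennreal q) f"
  defines "K \<equiv> (1 + (2::real) ^ CARD('n)) * (8 * (1 + 2 ^ CARD('n))) powr (1 / (q - 1))"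
  shows "\<exists>g. atom \<infinity> g \<and> atomic_sum (ennreal q) (1 / 2) (\<lambda>z. f z - of_real K * g z)"
proof -
  define D where "D = (2::real) ^ CARD('n)"
  define \<alpha> where "\<alpha> = (8 * (1 + D)) powr (1 / (q - 1))"
  have K: "K = (1 + D) * \<alpha>" by (simp add: K_def D_def \<alpha>_def)
  obtain C where C: "C \<in> cz_cells" "f \<in> borel_measurable rho" "AE z in rho. z \<notin> C \<longrightarrow> f z = 0"
    "(\<integral>\<^sup>+z. ennreal (norm (f z) powr q) \<partial>rho) \<le> ennreal (measure rho C powr (1 - q))" "has_bochner_integral rho f 0"
    using f unfolding atom_iff[OF q] by blast
  note [measurable] = C(2)
  define V where "V = measure rho C"
  have V: "V > 0" "emeasure rho C = ennreal V" "C \<in> sets rho" using cz_cell_measure[OF C(1)] by (auto simp: V_def)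
  note [measurable] = V(3)
  have D: "D \<ge> 1" by (simp add: D_def)
  have \<alpha>: "\<alpha> > 0" "\<alpha> \<ge> 1" using D q by (auto simp: \<alpha>_def intro!: ge_one_powr_ge_zero)
  have \<alpha>q: "\<alpha> powr (1 - q) = 1 / (8 * (1 + D))"
  proof -
    have "1 / (q - 1) * (1 - q) = - 1" using q by (simp add: field_simps)
    then show ?thesis using D by (simp add: \<alpha>_def powr_powr powr_minus_divide)
  qed
  define s where "s = \<alpha> / V"
  have s: "s > 0" using \<alpha> V by (simp add: s_def)
  define t where "t = s powr q"
  have t: "t > 0" using s by (simp add: t_def)
  have st: "s powr (1 - q) * t = s" using s by (simp add: t_def flip: powr_add)
  define I where "I A = (\<integral>\<^sup>+z. ennreal (norm (f z) powr q) * indicator A z \<partial>rho)" for A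
  have tV: "V powr (1 - q) \<le> t * V"
  proof -
    have "V powr (1 - q) = V powr (- q) * V" using V by (simp add: powr_diff powr_minus_divide)
    also have "\<dots> \<le> \<alpha> powr q * (V powr (- q) * V)"
      using ge_one_powr_ge_zero[OF \<alpha>(2), of q] q V by simp
    also have "\<dots> = t * V" using V by (simp add: t_def s_def powr_divide powr_minus_divide)
    finally show ?thesis .
  qed
  have avg: "(\<integral>\<^sup>+z. ennreal (norm (f z) powr q) \<partial>rho) \<le> ennreal (t * measure rho C)"
    using C(4) ennreal_leI[OF tV] unfolding V_def by (rule order_trans)
  obtain e :: "nat \<Rightarrow> ((real^'n) \<times> real) set" where
    e: "\<And>i. e i = {} \<or> e i \<in> cz_cells" "disjoint_family e" "\<And>i. e i \<subseteq> C"
    "\<And>i. ennreal (t * measure rho (e i)) \<le> I (e i)"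
    "\<And>i. I (e i) \<le> ennreal (t * (D * measure rho (e i)))"
    "AE z in rho. z \<in> C - (\<Union>i. e i) \<longrightarrow> norm (f z) powr q \<le> t"
    using cz_covering_rho[OF C(1), of "\<lambda>z. norm (f z) powr q" t] t avg unfolding I_def D_def by auto
  define m where "m i = measure rho (e i)" for i
  have em: "e i \<in> sets rho" "emeasure rho (e i) = ennreal (m i)" "m i \<ge> 0" "e i \<noteq> {} \<Longrightarrow> m i > 0" for i
    using e(1)[of i] cz_cell_measure by (auto simp: m_def)
  note [measurable] = em(1)
  have fint: "integrable rho f" using C(5) by (simp add: has_bochner_integral_iff)

  \<comment> \<open>averages over stopped cells; truncation at height \<open>s\<close> bounds them\<close>
  define avgf where "avgf i = (LINT z|rho. indicator (e i) z *\<^sub>R f z) / of_real (m i)" for i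
  have avgf: "norm (avgf i) \<le> (1 + D) * s" for i
  proof (cases "e i = {}")
    case True
    then show ?thesis using D s by (simp add: avgf_def)
  next
    case False
    then have mi: "m i > 0" using em by blast
    have "ennreal (norm (LINT z|rho. indicator (e i) z *\<^sub>R f z)) \<le> (\<integral>\<^sup>+z. ennreal (norm (indicator (e i) z *\<^sub>R f z)) \<partial>rho)"
      using fint by (intro integral_norm_bound_ennreal integrable_mult_indicator) auto
    also have "\<dots> \<le> (\<integral>\<^sup>+z. ennreal s * indicator (e i) z + ennreal (s powr (1 - q)) * (ennreal (norm (f z) powr q) * indicator (e i) z) \<partial>rho)"
    proof (intro nn_integral_mono)
      fix z
      have "norm (f z) \<le> s + s powr (1 - q) * norm (f z) powr q"
        using s q by (intro truncation_bound) auto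
      then have "ennreal (norm (f z)) \<le> ennreal (s + s powr (1 - q) * norm (f z) powr q)" by (rule ennreal_leI)
      also have "\<dots> = ennreal s + ennreal (s powr (1 - q)) * ennreal (norm (f z) powr q)"
        using s by (simp add: ennreal_mult ennreal_plus)
      finally show "ennreal (norm (indicator (e i) z *\<^sub>R f z)) \<le>
        ennreal s * indicator (e i) z + ennreal (s powr (1 - q)) * (ennreal (norm (f z) powr q) * indicator (e i) z)"
        by (auto split: split_indicator)
    qed
    also have "\<dots> = ennreal s * ennreal (m i) + ennreal (s powr (1 - q)) * I (e i)"
      unfolding I_def by (subst nn_integral_add) (auto simp: nn_integral_cmult nn_integral_cmult_indicator em)
    also have "\<dots> \<le> ennreal s * ennreal (m i) + ennreal (s powr (1 - q)) * ennreal (t * (D * m i))"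
      using e(5)[of i] by (intro add_left_mono mult_left_mono) (auto simp: m_def)
    also have "\<dots> = ennreal (s * m i + s powr (1 - q) * (t * (D * m i)))"
      using s t D mi by (simp add: ennreal_mult ennreal_plus)
    also have "s powr (1 - q) * (t * (D * m i)) = s * (D * m i)" using st by (simp add: mult.assoc[symmetric])
    finally have "norm (LINT z|rho. indicator (e i) z *\<^sub>R f z) \<le> s * m i + s * (D * m i)"
      using s D mi by (subst (asm) ennreal_le_iff) auto
    then show ?thesis using mi by (simp add: avgf_def norm_divide field_simps)
  qed

  define bad where "bad i z = indicator (e i) z *\<^sub>R (f z - avgf i)" for i z
  have bad_meas [measurable]: "bad i \<in> borel_measurable rho" for i unfolding bad_def by measurable
  have bad_int: "has_bochner_integral rho (bad i) 0" for i
  proof (cases "e i = {}")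
    case True
    then have "bad i = (\<lambda>_. 0)" by (simp add: bad_def fun_eq_iff)
    then show ?thesis by (simp add: has_bochner_integral_zero)
  next
    case False
    then have mi: "m i > 0" using em by blast
    have 1: "integrable rho (\<lambda>z. indicator (e i) z *\<^sub>R f z)" using fint em by (intro integrable_mult_indicator) auto
    have 2: "integrable rho (\<lambda>z. indicator (e i) z *\<^sub>R avgf i)"
      using em by (intro integrable_indicator) (auto simp: order_le_less_trans[OF _ ennreal_less_top])
    have "(LINT z|rho. bad i z) = (LINT z|rho. indicator (e i) z *\<^sub>R f z) - (LINT z|rho. indicator (e i) z *\<^sub>R avgf i)"
      unfolding bad_def scaleR_diff_right using 1 2 by (rule Bochner_Integration.integral_diff)
    also have "(LINT z|rho. indicator (e i) z *\<^sub>R avgf i) = m i *\<^sub>R avgf i"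
      unfolding m_def using em(1,2)[of i]
      by (intro has_bochner_integral_integral_eq has_bochner_integral_indicator)
        (auto simp: order_le_less_trans[OF _ ennreal_less_top])
    also have "\<dots> = (LINT z|rho. indicator (e i) z *\<^sub>R f z)"
      using mi by (simp add: avgf_def scaleR_conv_of_real)
    finally show ?thesis using 1 2 by (simp add: has_bochner_integral_iff bad_def[abs_def] scaleR_diff_right)
  qed

  \<comment> \<open>the factor \<open>4 (1 + D)\<close> normalises \<open>f - avgf\<close> in \<open>L\<^sup>q\<close>; for an empty \<open>e i\<close> both \<open>lam i\<close> and
    \<open>b i\<close> vanish, the latter by \<open>x / 0 = 0\<close>\<close>
  define lam where "lam i = 4 * (1 + D) * s * m i" for i
  have lam0: "lam i \<ge> 0" for i using D s em by (simp add: lam_def)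
  define b where "b i z = bad i z / of_real (lam i)" for i z
  have lamb: "of_real (lam i) * b i z = bad i z" for i z
  proof (cases "e i = {}")
    case False
    then have "lam i > 0" using D s em by (simp add: lam_def)
    then show ?thesis by (simp add: b_def)
  qed (simp add: bad_def b_def)
  have b_atom: "atom (ennreal q) (b i)" for i
  proof (cases "e i = {}")
    case True
    then have "b i = (\<lambda>_. 0)" by (simp add: b_def bad_def fun_eq_iff)
    then show ?thesis using atom_zero[OF C(1) q] by simp
  next
    case False
    then have cell: "e i \<in> cz_cells" and mi: "m i > 0" using e(1) em by blast+
    have lami: "lam i > 0" using mi D s by (simp add: lam_def)
    have "(\<integral>\<^sup>+z. ennreal (norm (b i z) powr q) \<partial>rho) \<le>
      (\<integral>\<^sup>+z. ennreal ((2 / lam i) powr q) * (ennreal (norm (f z) powr q) * indicator (e i) z + ennreal (((1 + D) * s) powr q) * indicator (e i) z) \<partial>rho)"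
    proof (intro nn_integral_mono)
      fix z
      have "norm (f z - avgf i) powr q \<le> (norm (f z) + (1 + D) * s) powr q"
        using norm_triangle_ineq4[of "f z" "avgf i"] avgf[of i] q by (intro powr_mono2) auto
      also have "\<dots> \<le> 2 powr q * (norm (f z) powr q + ((1 + D) * s) powr q)"
        using q D s by (intro powr_add_le) auto
      finally have "norm (f z - avgf i) powr q / lam i powr q \<le> 2 powr q * (norm (f z) powr q + ((1 + D) * s) powr q) / lam i powr q"
        by (intro divide_right_mono) auto
      then have "ennreal (norm ((f z - avgf i) / of_real (lam i)) powr q) \<le> ennreal ((2 / lam i) powr q * (norm (f z) powr q + ((1 + D) * s) powr q))"
        using lami by (intro ennreal_leI) (simp add: norm_divide powr_divide)
      also have "\<dots> = ennreal ((2 / lam i) powr q) * (ennreal (norm (f z) powr q) + ennreal (((1 + D) * s) powr q))"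
        by (simp add: ennreal_mult ennreal_plus)
      finally show "ennreal (norm (b i z) powr q) \<le> ennreal ((2 / lam i) powr q) * (ennreal (norm (f z) powr q) * indicator (e i) z + ennreal (((1 + D) * s) powr q) * indicator (e i) z)"
        by (auto simp: b_def bad_def split: split_indicator)
    qed
    also have "\<dots> = ennreal ((2 / lam i) powr q) * (I (e i) + ennreal (((1 + D) * s) powr q) * ennreal (m i))"
      unfolding I_def using em(1)[of i] by (simp add: nn_integral_cmult nn_integral_add nn_integral_cmult_indicator em(2))
    also have "\<dots> \<le> ennreal ((2 / lam i) powr q) * (ennreal (t * (D * m i)) + ennreal (((1 + D) * s) powr q) * ennreal (m i))"
      using e(5)[of i] by (intro mult_left_mono add_right_mono) (auto simp: m_def)
    also have "\<dots> = ennreal ((2 / lam i) powr q * (t * (D * m i) + ((1 + D) * s) powr q * m i))"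
      using t D mi by (simp add: ennreal_mult ennreal_plus)
    also have "\<dots> \<le> ennreal (m i powr (1 - q))"
    proof (intro ennreal_leI)
      have "D \<le> (1 + D) powr 1" using D by simp
      also have "\<dots> \<le> (1 + D) powr q" using D q by (intro powr_mono) auto
      finally have Dq: "D \<le> (1 + D) powr q" .
      have two: "2 \<le> 2 powr q" using q powr_mono[of 1 q 2] by simp
      have "t * (D * m i) + ((1 + D) * s) powr q * m i = (D + (1 + D) powr q) * (t * m i)"
        unfolding powr_mult t_def by (simp add: algebra_simps)
      also have "\<dots> \<le> (2 * (1 + D) powr q) * (t * m i)" using Dq t mi by (intro mult_right_mono) auto
      also have "\<dots> \<le> (2 powr q * (1 + D) powr q) * (t * m i)" using two t mi by (intro mult_right_mono) auto
      finally have "(2 / lam i) powr q * (t * (D * m i) + ((1 + D) * s) powr q * m i) \<le> (2 / lam i) powr q * ((2 powr q * (1 + D) powr q) * (t * m i))"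
        by (intro mult_left_mono) auto
      also have "\<dots> = (2 / lam i * 2 * (1 + D) * s) powr q * m i"
        unfolding powr_mult t_def by (simp only: mult.assoc)
      also have "2 / lam i * 2 * (1 + D) * s = 1 / m i"
      proof -
        have "1 + D \<noteq> 0" using D by linarith
        then show ?thesis using s mi by (simp add: lam_def divide_simps)
      qed
      also have "(1 / m i) powr q * m i = m i powr (1 - q)" using mi by (simp add: powr_divide powr_diff)
      finally show "(2 / lam i) powr q * (t * (D * m i) + ((1 + D) * s) powr q * m i) \<le> m i powr (1 - q)" .
    qed
    finally have size: "(\<integral>\<^sup>+z. ennreal (norm (b i z) powr q) \<partial>rho) \<le> ennreal (measure rho (e i) powr (1 - q))"
      by (simp add: m_def)
    have "has_bochner_integral rho (b i) 0"
      using has_bochner_integral_divide_zero[of "of_real (lam i)" rho "bad i" 0] bad_int[of i] by (simp add: b_def[abs_def])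
    moreover have "b i \<in> borel_measurable rho" unfolding b_def by measurable
    moreover have "AE z in rho. z \<notin> e i \<longrightarrow> b i z = 0" by (simp add: b_def bad_def)
    ultimately show ?thesis unfolding atom_iff[OF q] using cell size by blast
  qed

  \<comment> \<open>the integral of \<open>|f|\<^sup>q\<close> over the disjoint stopped cells controls their total measure\<close>
  have sum_lam: "summable lam \<and> suminf lam \<le> 1 / 2"
  proof -
    have "(\<Sum>i. ennreal (t * m i)) \<le> (\<Sum>i. I (e i))" using e(4) by (intro suminf_le) (auto simp: m_def)
    also have "\<dots> = (\<integral>\<^sup>+z. (\<Sum>i. ennreal (norm (f z) powr q) * indicator (e i) z) \<partial>rho)"
      unfolding I_def by (subst nn_integral_suminf) auto
    also have "\<dots> \<le> (\<integral>\<^sup>+z. ennreal (norm (f z) powr q) \<partial>rho)"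
    proof (intro nn_integral_mono)
      fix z
      have "(\<Sum>i. ennreal (norm (f z) powr q) * indicator (e i) z) = ennreal (norm (f z) powr q) * indicator (\<Union>i. e i) z"
        using e(2) by (simp add: suminf_indicator)
      then show "(\<Sum>i. ennreal (norm (f z) powr q) * indicator (e i) z) \<le> ennreal (norm (f z) powr q)"
        by (simp split: split_indicator)
    qed
    also have "\<dots> \<le> ennreal (V powr (1 - q))" using C(4) by (simp add: V_def)
    finally have le: "(\<Sum>i. ennreal (t * m i)) \<le> ennreal (V powr (1 - q))" .
    have nn: "t * m i \<ge> 0" for i using t em by simp
    have sm: "summable (\<lambda>i. t * m i)"
      using le nn by (intro summable_suminf_not_top) (auto simp: top_unique)
    then have "ennreal (\<Sum>i. t * m i) \<le> ennreal (V powr (1 - q))"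
      using le suminf_ennreal2[OF nn sm] by simp
    then have le': "(\<Sum>i. t * m i) \<le> V powr (1 - q)" by (simp add: ennreal_le_iff)
    define k where "k = 4 * (1 + D) * s powr (1 - q)"
    have k: "k \<ge> 0" using D by (simp add: k_def)
    have lamk: "lam i = k * (t * m i)" for i
    proof -
      have "k * (t * m i) = 4 * (1 + D) * (s powr (1 - q) * t) * m i" unfolding k_def by (simp only: mult_ac)
      also have "\<dots> = lam i" by (simp only: st lam_def)
      finally show ?thesis by (rule sym)
    qed
    have "suminf lam = k * (\<Sum>i. t * m i)" unfolding lamk[abs_def] using sm by (rule suminf_mult)
    also have "\<dots> \<le> k * V powr (1 - q)" using le' k by (intro mult_left_mono) auto
    also have "\<dots> = 4 * (1 + D) * (s * V) powr (1 - q)" by (simp add: k_def powr_mult mult_ac)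
    also have "s * V = \<alpha>" using V by (simp add: s_def)
    also have "4 * (1 + D) * \<alpha> powr (1 - q) = 1 / 2" unfolding \<alpha>q using D by (simp add: field_simps)
    finally show ?thesis using sm unfolding lamk[abs_def] by (auto intro: summable_mult)
  qed

  \<comment> \<open>pointwise the series has at most one nonzero term, so \<open>g\<close> is \<open>avgf i\<close> on \<open>e i\<close> and \<open>f\<close>
    elsewhere\<close>
  define g where "g z = (f z - (\<Sum>i. bad i z))" for z
  have bad_single: "bad i z = 0" if "z \<in> e j" "i \<noteq> j" for i j z
    using e(2) that by (auto simp: bad_def disjoint_family_on_def split: split_indicator)
  have g_in: "g z = avgf j \<and> (\<lambda>i. bad i z) sums (f z - g z) \<and> (\<forall>n. norm (\<Sum>i<n. bad i z) \<le> norm (f z - g z))"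
    if "z \<in> e j" for j z
  proof -
    have s: "(\<lambda>i. bad i z) sums bad j z"
      using sums_finite[of "{j}" "\<lambda>i. bad i z"] bad_single[OF that] by simp
    have g: "f z - g z = bad j z" using sums_unique[OF s] by (simp add: g_def)
    moreover have "bad j z = f z - avgf j" using that by (simp add: bad_def)
    moreover have "norm (\<Sum>i<n. bad i z) \<le> norm (bad j z)" for n
    proof -
      have "(\<Sum>i<n. bad i z) = (\<Sum>i<n. if i = j then bad j z else 0)"
        using bad_single[OF that] by (intro sum.cong) auto
      then show ?thesis by simp
    qed
    ultimately show ?thesis using s by simp
  qed
  have g_out: "g z = f z \<and> (\<forall>i. bad i z = 0)" if "z \<notin> (\<Union>i. e i)" for z
  proof -
    have "bad i z = 0" for i using that by (simp add: bad_def)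
    then show ?thesis by (simp add: g_def)
  qed
  have bad_sums: "(\<lambda>i. bad i z) sums (f z - g z)" for z
    using g_in[of z] g_out[of z] by (cases "z \<in> (\<Union>i. e i)") auto
  have bad_le: "norm (\<Sum>i<n. bad i z) \<le> norm (f z - g z)" for n z
    using g_in[of z] g_out[of z] by (cases "z \<in> (\<Union>i. e i)") auto
  have g_meas [measurable]: "g \<in> borel_measurable rho"
  proof -
    have [measurable]: "(\<lambda>z. f z - g z) \<in> borel_measurable rho"
      by (rule borel_measurable_LIMSEQ_metric[of "\<lambda>n z. \<Sum>i<n. bad i z"])
        (use bad_sums in \<open>auto simp: sums_def\<close>)
    have "(\<lambda>z. f z - (f z - g z)) \<in> borel_measurable rho" by measurable
    then show ?thesis by simp
  qed
  have g_supp: "AE z in rho. z \<notin> C \<longrightarrow> g z = 0"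
    using C(3)
  proof eventually_elim
    case (elim z)
    show ?case
    proof
      assume "z \<notin> C"
      then have "z \<notin> (\<Union>i. e i)" using e(3) by blast
      then show "g z = 0" using g_out elim \<open>z \<notin> C\<close> by simp
    qed
  qed
  have g_bound: "AE z in rho. norm (g z) \<le> (1 + D) * s"
    using C(3) e(6)
  proof eventually_elim
    case (elim z)
    show ?case
    proof (cases "z \<in> (\<Union>i. e i)")
      case True
      then obtain j where "z \<in> e j" by blast
      then show ?thesis using g_in avgf by simp
    next
      case False
      have "norm (f z) \<le> s"
      proof (cases "z \<in> C")
        case True
        then have "norm (f z) powr q \<le> s powr q" using elim False by (simp add: t_def)
        then show ?thesis using powr_less_mono2[of q s "norm (f z)"] q s by (meson less_imp_le not_le order_less_trans zero_less_one)
      qed (use elim s in auto)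
      also have "1 * s \<le> (1 + D) * s" using D s by (intro mult_right_mono) auto
      finally show ?thesis using g_out[OF False] by simp
    qed
  qed
  have g_integrable: "integrable rho g"
    by (rule integrableI_bounded_set[where A = C and B = "(1 + D) * s"])
      (use g_bound g_supp V in \<open>auto elim: eventually_mono\<close>)
  have g_integral: "has_bochner_integral rho g 0"
  proof -
    have "(\<lambda>n. LINT z|rho. (\<Sum>i<n. bad i z)) \<longlonglongrightarrow> (LINT z|rho. f z - g z)"
    proof (rule integral_dominated_convergence[where w = "\<lambda>z. norm (f z - g z)"])
      show "integrable rho (\<lambda>z. norm (f z - g z))" using fint g_integrable by simp
    qed (use bad_sums bad_le in \<open>auto simp: sums_def\<close>)
    moreover have "(LINT z|rho. (\<Sum>i<n. bad i z)) = 0" for n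
      using bad_int by (subst Bochner_Integration.integral_sum) (auto simp: has_bochner_integral_iff)
    ultimately have "(LINT z|rho. f z - g z) = 0" by (simp add: LIMSEQ_const_iff)
    then have "(LINT z|rho. g z) = 0"
      using fint g_integrable C(5) by (simp add: has_bochner_integral_iff)
    then show ?thesis using g_integrable by (simp add: has_bochner_integral_iff)
  qed

  have K0: "K > 0" using D \<alpha> by (simp add: K)
  have "atom \<infinity> (\<lambda>z. g z / of_real K)"
    unfolding atom_top_iff
  proof (intro bexI[OF _ C(1)] conjI)
    show "AE z in rho. z \<notin> C \<longrightarrow> g z / of_real K = 0" using g_supp by eventually_elim auto
    show "AE z in rho. norm (g z / of_real K) \<le> 1 / measure rho C"
      using g_bound
    proof eventually_elim
      case (elim z)
      have "(1 + D) * s / K = 1 / V" using D \<alpha> by (simp add: K s_def)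
      then show ?case using elim K0 divide_right_mono[of "norm (g z)" "(1 + D) * s" K] by (simp add: norm_divide V_def)
    qed
    show "has_bochner_integral rho (\<lambda>z. g z / of_real K) 0"
      using has_bochner_integral_divide_zero[of "of_real K" rho g 0] g_integral by simp
  qed measurable
  moreover have "atomic_sum (ennreal q) (1 / 2) (\<lambda>z. f z - of_real K * (g z / of_real K))"
    unfolding atomic_sum_def
  proof (intro exI conjI allI)
    show "atom (ennreal q) (b i)" for i by (rule b_atom)
    show "summable (\<lambda>i. norm (of_real (lam i) :: complex))" "(\<Sum>i. norm (of_real (lam i) :: complex)) \<le> 1 / 2"
      using lam0 sum_lam by simp_all
    show "AE z in rho. (\<lambda>i. of_real (lam i) * b i z) sums (f z - of_real K * (g z / of_real K))"
      unfolding lamb using bad_sums K0 by simp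
  qed
  ultimately show ?thesis by blast
qed

section \<open>Series of atoms\<close>

lemma exponent_cases:
  assumes "1 < (p::ennreal)"
  obtains "p = \<infinity>" | q where "p = ennreal q" "q > 1"
proof (cases p rule: ennreal_cases)
  case (real r)
  then have "r > 1" using assms by (metis ennreal_1 ennreal_less_iff zero_le_one)
  then show ?thesis using real that(2) by blast
qed (use that(1) in simp)

lemma atom_L1:
  assumes "1 < p" "atom p f"
  shows "f \<in> borel_measurable rho" "integrable rho f" "(\<integral>\<^sup>+z. ennreal (norm (f z)) \<partial>rho) \<le> 2"
proof -
  show "f \<in> borel_measurable rho" "integrable rho f"
    using assms(2) by (auto simp: atom_def has_bochner_integral_iff)
  from assms(1) show "(\<integral>\<^sup>+z. ennreal (norm (f z)) \<partial>rho) \<le> 2"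
  proof (cases rule: exponent_cases)
    case 1
    then show ?thesis using assms(2) atom_top_imp_atom[of f 2] atom_L1_bound[of 2 f] by simp
  next
    case (2 q)
    then show ?thesis using assms(2) atom_L1_bound[of q f] by simp
  qed
qed

text \<open>
  Since the atoms are bounded in \<open>L\<^sup>1\<close>, a series of atoms with summable coefficients converges
  absolutely almost everywhere.
\<close>

lemma atomic_series_nn_integral:
  fixes A :: "nat \<Rightarrow> (real^'n) \<times> real \<Rightarrow> complex"
  assumes p: "1 < p" and A: "\<And>j. atom p (A j)" and c: "summable (\<lambda>j. norm (c j))"
  shows "(\<integral>\<^sup>+z. (\<Sum>j. ennreal (norm (c j * A j z))) \<partial>rho) \<le> ennreal (2 * (\<Sum>j. norm (c j)))"
proof -
  note [measurable] = atom_L1(1)[OF p A]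
  have "(\<integral>\<^sup>+z. (\<Sum>j. ennreal (norm (c j * A j z))) \<partial>rho) = (\<Sum>j. \<integral>\<^sup>+z. ennreal (norm (c j * A j z)) \<partial>rho)"
    by (intro nn_integral_suminf) auto
  also have "\<dots> \<le> (\<Sum>j. ennreal (2 * norm (c j)))"
  proof (intro suminf_le allI)
    fix j
    have "(\<integral>\<^sup>+z. ennreal (norm (c j * A j z)) \<partial>rho) = ennreal (norm (c j)) * (\<integral>\<^sup>+z. ennreal (norm (A j z)) \<partial>rho)"
      by (simp add: norm_mult ennreal_mult nn_integral_cmult)
    also have "\<dots> \<le> ennreal (norm (c j)) * 2"
      using atom_L1(3)[OF p A] by (intro mult_left_mono) auto
    also have "\<dots> = ennreal (2 * norm (c j))" by (simp add: ennreal_mult mult.commute)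
    finally show "(\<integral>\<^sup>+z. ennreal (norm (c j * A j z)) \<partial>rho) \<le> ennreal (2 * norm (c j))" .
  qed auto
  also have "\<dots> = ennreal (2 * (\<Sum>j. norm (c j)))"
    using c by (subst suminf_ennreal2) (auto simp: suminf_mult)
  finally show ?thesis .
qed

lemma atomic_series_AE_summable:
  fixes A :: "nat \<Rightarrow> (real^'n) \<times> real \<Rightarrow> complex"
  assumes p: "1 < p" and A: "\<And>j. atom p (A j)" and c: "summable (\<lambda>j. norm (c j))"
  shows "AE z in rho. summable (\<lambda>j. norm (c j * A j z))"
proof -
  note [measurable] = atom_L1(1)[OF p A]
  have "(\<integral>\<^sup>+z. (\<Sum>j. ennreal (norm (c j * A j z))) \<partial>rho) \<noteq> \<infinity>"
    using atomic_series_nn_integral[where A = A, OF assms] by (auto simp: top_unique)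
  then have "AE z in rho. (\<Sum>j. ennreal (norm (c j * A j z))) \<noteq> \<infinity>"
    by (intro nn_integral_noteq_infinite) auto
  then show ?thesis by eventually_elim (auto intro!: summable_suminf_not_top)
qed

lemma atomic_series_L1_converges:
  fixes A :: "nat \<Rightarrow> (real^'n) \<times> real \<Rightarrow> complex"
  assumes p: "1 < p" and A: "\<And>j. atom p (A j)" and c: "summable (\<lambda>j. norm (c j))"
    and h: "integrable rho h" and sums: "AE z in rho. (\<lambda>j. c j * A j z) sums h z"
  shows "(\<lambda>n. LINT z|rho. norm (h z - (\<Sum>j<n. c j * A j z))) \<longlonglongrightarrow> 0"
proof -
  note [measurable] = atom_L1(1)[OF p A] and [simp] = atom_L1(2)[OF p A]
  have [measurable]: "h \<in> borel_measurable rho" using h by auto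
  define W where "W z = (\<Sum>j. ennreal (norm (c j * A j z)))" for z
  have [measurable]: "W \<in> borel_measurable rho" unfolding W_def by measurable
  have W: "(\<integral>\<^sup>+z. W z \<partial>rho) < \<infinity>"
    using atomic_series_nn_integral[where A = A, OF p A c] unfolding W_def by (simp add: order_le_less_trans[OF _ ennreal_less_top])
  have Wfin: "AE z in rho. W z \<noteq> \<infinity>" using W by (intro nn_integral_noteq_infinite) auto
  define w where "w z = enn2real (W z)" for z
  have Ww: "AE z in rho. W z = ennreal (w z)" using Wfin by eventually_elim (simp add: w_def less_top)
  have [measurable]: "w \<in> borel_measurable rho" unfolding w_def by measurable
  have wint: "integrable rho w"
  proof (rule integrableI_bounded)
    have "(\<integral>\<^sup>+z. ennreal (norm (w z)) \<partial>rho) = (\<integral>\<^sup>+z. W z \<partial>rho)"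
      using Ww by (intro nn_integral_cong_AE) (auto simp: w_def elim!: eventually_mono)
    then show "(\<integral>\<^sup>+z. ennreal (norm (w z)) \<partial>rho) < \<infinity>" using W by simp
  qed measurable
  have "(\<lambda>n. LINT z|rho. norm (h z - (\<Sum>j<n. c j * A j z))) \<longlonglongrightarrow> (LINT z|(rho :: ((real^'n) \<times> real) measure). 0 :: real)"
  proof (rule integral_dominated_convergence[where w = "\<lambda>z. norm (h z) + w z"])
    show "AE z in rho. (\<lambda>n. norm (h z - (\<Sum>j<n. c j * A j z))) \<longlonglongrightarrow> 0"
      using sums
    proof eventually_elim
      case (elim z)
      then have "(\<lambda>n. norm (h z - (\<Sum>j<n. c j * A j z))) \<longlonglongrightarrow> norm (h z - h z)"
        unfolding sums_def by (intro tendsto_intros)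
      then show ?case by simp
    qed
    show "AE z in rho. norm (norm (h z - (\<Sum>j<n. c j * A j z))) \<le> norm (h z) + w z" for n
      using Ww
    proof eventually_elim
      case (elim z)
      have "(\<Sum>j<n. ennreal (norm (c j * A j z))) \<le> ennreal (w z)"
        unfolding elim[symmetric] W_def by (intro sum_le_suminf) auto
      then have "(\<Sum>j<n. norm (c j * A j z)) \<le> w z"
        by (simp add: sum_nonneg w_def sum_ennreal ennreal_le_iff)
      moreover have "norm (\<Sum>j<n. c j * A j z) \<le> (\<Sum>j<n. norm (c j * A j z))" by (rule norm_sum)
      ultimately show ?case using norm_triangle_ineq4[of "h z" "\<Sum>j<n. c j * A j z"] by simp
    qed
  qed (use h wint in auto)
  then show ?thesis by simp
qed

lemma Lp_norm_1:
  assumes "integrable M f"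
  shows "Lp_norm M 1 f = ennreal (LINT z|M. norm (f z))"
  using assms by (simp add: Lp_norm_def)

text \<open>
  A series of atoms has a sum \<open>S\<close> in both senses, so convergence to \<open>h\<close> in either sense means
  \<open>h = S\<close> almost everywhere.
\<close>

lemma atomic_decomp_iff:
  fixes A :: "nat \<Rightarrow> (real^'n) \<times> real \<Rightarrow> complex"
  assumes p: "1 < p" and h: "integrable rho h"
  shows "atomic_decomp p h c A \<longleftrightarrow> (\<forall>j. atom p (A j)) \<and> summable (\<lambda>j. norm (c j)) \<and>
    (AE z in rho. (\<lambda>j. c j * A j z) sums h z)"
proof -
  have "((\<lambda>n. Lp_norm rho 1 (\<lambda>z. h z - (\<Sum>j<n. c j * A j z))) \<longlonglongrightarrow> 0) \<longleftrightarrow> (AE z in rho. (\<lambda>j. c j * A j z) sums h z)"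
    if A: "\<And>j. atom p (A j)" and c: "summable (\<lambda>j. norm (c j))"
  proof -
    note [measurable] = atom_L1(1)[OF p A] and [simp] = atom_L1(2)[OF p A]
    have L: "((\<lambda>n. Lp_norm rho 1 (\<lambda>z. h z - (\<Sum>j<n. c j * A j z))) \<longlonglongrightarrow> 0) \<longleftrightarrow>
      (\<lambda>n. LINT z|rho. norm (h z - (\<Sum>j<n. c j * A j z))) \<longlonglongrightarrow> 0"
      using h by (simp add: Lp_norm_1 ennreal_tendsto_0_iff)
    define S where "S z = (\<Sum>j. c j * A j z)" for z
    have sums: "AE z in rho. (\<lambda>j. c j * A j z) sums S z"
      using atomic_series_AE_summable[where A = A, OF p A c]
      by eventually_elim (auto simp: S_def intro!: summable_sums dest: summable_norm_cancel)
    have S: "integrable rho S"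
      unfolding S_def
    proof (rule integrable_suminf)
      show "AE z in rho. summable (\<lambda>j. norm (c j * A j z))" by (rule atomic_series_AE_summable[where A = A, OF p A c])
      have "(LINT z|rho. norm (A j z)) \<le> 2" for j
      proof -
        have "ennreal (LINT z|rho. norm (A j z)) = (\<integral>\<^sup>+z. ennreal (norm (A j z)) \<partial>rho)"
          by (intro nn_integral_eq_integral[symmetric]) auto
        also have "\<dots> \<le> ennreal 2" using atom_L1(3)[OF p A] by simp
        finally show ?thesis by (subst (asm) ennreal_le_iff) auto
      qed
      then have "(LINT z|rho. norm (c j * A j z)) \<le> norm (c j) * 2" for j
        by (simp add: norm_mult mult_left_mono)
      then show "summable (\<lambda>j. LINT z|rho. norm (c j * A j z))"
        by (intro summable_comparison_test'[OF summable_mult2[OF c, of 2]]) auto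
    qed auto
    note convS = atomic_series_L1_converges[where A = A, OF p A c S sums]
    show ?thesis
    proof
      assume "(\<lambda>n. Lp_norm rho 1 (\<lambda>z. h z - (\<Sum>j<n. c j * A j z))) \<longlonglongrightarrow> 0"
      then have convh: "(\<lambda>n. LINT z|rho. norm (h z - (\<Sum>j<n. c j * A j z))) \<longlonglongrightarrow> 0" unfolding L .
      have "(LINT z|rho. norm (h z - S z)) \<le> (LINT z|rho. norm (h z - (\<Sum>j<n. c j * A j z))) + (LINT z|rho. norm (S z - (\<Sum>j<n. c j * A j z)))" for n
      proof -
        have "(LINT z|rho. norm (h z - S z)) \<le> (LINT z|rho. norm (h z - (\<Sum>j<n. c j * A j z)) + norm (S z - (\<Sum>j<n. c j * A j z)))"
        proof (rule integral_mono)
          fix z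
          show "norm (h z - S z) \<le> norm (h z - (\<Sum>j<n. c j * A j z)) + norm (S z - (\<Sum>j<n. c j * A j z))"
            using norm_triangle_ineq4[of "h z - (\<Sum>j<n. c j * A j z)" "S z - (\<Sum>j<n. c j * A j z)"] by simp
        qed (use h S in auto)
        also have "\<dots> = (LINT z|rho. norm (h z - (\<Sum>j<n. c j * A j z))) + (LINT z|rho. norm (S z - (\<Sum>j<n. c j * A j z)))"
          using h S by (intro Bochner_Integration.integral_add) auto
        finally show ?thesis .
      qed
      moreover have "(\<lambda>n. (LINT z|rho. norm (h z - (\<Sum>j<n. c j * A j z))) + (LINT z|rho. norm (S z - (\<Sum>j<n. c j * A j z)))) \<longlonglongrightarrow> 0 + 0"
        using convh convS by (rule tendsto_add)
      ultimately have "(LINT z|rho. norm (h z - S z)) \<le> 0 + 0"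
        by (intro LIMSEQ_le_const) auto
      then have "(LINT z|rho. norm (h z - S z)) = 0" by (simp add: antisym)
      then have "AE z in rho. norm (h z - S z) = 0"
        using h S by (subst (asm) integral_nonneg_eq_0_iff_AE) auto
      then show "AE z in rho. (\<lambda>j. c j * A j z) sums h z"
        using sums by eventually_elim simp
    next
      assume "AE z in rho. (\<lambda>j. c j * A j z) sums h z"
      then show "(\<lambda>n. Lp_norm rho 1 (\<lambda>z. h z - (\<Sum>j<n. c j * A j z))) \<longlonglongrightarrow> 0"
        unfolding L by (rule atomic_series_L1_converges[where A = A, OF p A c h])
    qed
  qed
  then show ?thesis unfolding atomic_decomp_def by blast
qed

lemma atomic_sum_scale:
  assumes "atomic_sum p N h"
  shows "atomic_sum p (norm c * N) (\<lambda>z. c * h z)"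
proof -
  obtain d A where A: "\<And>j. atom p (A j)" "summable (\<lambda>j. norm (d j))" "(\<Sum>j. norm (d j)) \<le> N"
    "AE z in rho. (\<lambda>j. d j * A j z) sums h z"
    using assms unfolding atomic_sum_def by blast
  show ?thesis
    unfolding atomic_sum_def
  proof (intro exI[of _ "\<lambda>j. c * d j"] exI[of _ A] conjI allI)
    show "atom p (A j)" for j by (rule A)
    show "summable (\<lambda>j. norm (c * d j))" using A(2) by (simp add: norm_mult summable_mult)
    show "(\<Sum>j. norm (c * d j)) \<le> norm c * N" using A(2,3) by (simp add: norm_mult suminf_mult mult_left_mono)
    show "AE z in rho. (\<lambda>j. c * d j * A j z) sums (c * h z)"
      using A(4)
    proof eventually_elim
      case (elim z)
      then show ?case using sums_mult[OF elim, of c] by (simp add: mult.assoc)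
    qed
  qed
qed

lemma sums_prod_decode:
  fixes G :: "nat \<Rightarrow> nat \<Rightarrow> complex"
  assumes abs: "summable (\<lambda>n. norm (case prod_decode n of (k, j) \<Rightarrow> G k j))"
    and rows: "\<And>k. G k sums g k" and g: "g sums h"
  shows "(\<lambda>n. case prod_decode n of (k, j) \<Rightarrow> G k j) sums h"
proof -
  let ?F = "\<lambda>(k, j). G k j"
  obtain T where T: "(\<lambda>n. ?F (prod_decode n)) sums T"
    using summable_sums[OF summable_norm_cancel[OF abs]] by blast
  have "((\<lambda>n. ?F (prod_decode n)) has_sum T) UNIV"
    using abs T by (intro norm_summable_imp_has_sum) auto
  then have F: "(?F has_sum T) (UNIV \<times> UNIV)"
    using has_sum_reindex_bij_betw[OF bij_prod_decode, of ?F T] by simp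
  have "(G k has_sum g k) UNIV" for k
  proof -
    have "G k summable_on UNIV"
      using summable_on_SigmaD1[of G UNIV "\<lambda>_. UNIV" k] F by (auto simp: summable_on_def)
    then obtain y where y: "(G k has_sum y) UNIV" by (auto simp: summable_on_def)
    then have "y = g k" using has_sum_imp_sums[OF y] rows[of k] sums_unique2 by blast
    then show ?thesis using y by simp
  qed
  then have "(g has_sum T) UNIV" using has_sum_SigmaD[OF F, of g] by simp
  then have "T = h" using g has_sum_imp_sums sums_unique2 by blast
  then show ?thesis using T by simp
qed

text \<open>
  Countable sums of atomic decompositions: the double series converges absolutely almost
  everywhere, so it can be arranged in a single sequence.
\<close>

lemma atomic_sum_series:
  fixes h :: "(real^'n) \<times> real \<Rightarrow> complex"
  assumes p: "1 < p" and g: "\<And>k. atomic_sum p (N k) (g k)" and N: "summable N" "suminf N \<le> N'"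
    and h: "AE z in rho. (\<lambda>k. g k z) sums h z"
  shows "atomic_sum p N' h"
proof -
  have "\<forall>k. \<exists>c A. (\<forall>j. atom p (A j)) \<and> summable (\<lambda>j. norm (c j)) \<and> (\<Sum>j. norm (c j)) \<le> N k \<and>
     (AE z in rho. (\<lambda>j. c j * A j z) sums g k z)"
    using g unfolding atomic_sum_def by blast
  from choice[OF this] obtain c where
    "\<forall>k. \<exists>A. (\<forall>j. atom p (A j)) \<and> summable (\<lambda>j. norm (c k j)) \<and> (\<Sum>j. norm (c k j)) \<le> N k \<and>
     (AE z in rho. (\<lambda>j. c k j * A j z) sums g k z)" ..
  from choice[OF this] obtain A where
    "\<forall>k. (\<forall>j. atom p (A k j)) \<and> summable (\<lambda>j. norm (c k j)) \<and> (\<Sum>j. norm (c k j)) \<le> N k \<and>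
     (AE z in rho. (\<lambda>j. c k j * A k j z) sums g k z)" ..
  then have cA: "\<And>k j. atom p (A k j)" "\<And>k. summable (\<lambda>j. norm (c k j))" "\<And>k. (\<Sum>j. norm (c k j)) \<le> N k"
     "\<And>k. AE z in rho. (\<lambda>j. c k j * A k j z) sums g k z"
    by simp_all
  define c' where "c' n = (case prod_decode n of (k, j) \<Rightarrow> c k j)" for n
  define A' where "A' n = (case prod_decode n of (k, j) \<Rightarrow> A k j)" for n
  have A': "atom p (A' n)" for n using cA(1) by (simp add: A'_def split: prod.split)
  have Nk: "0 \<le> N k" for k
    using cA(2,3)[of k] suminf_nonneg[OF cA(2)[of k]] by simp
  have "(\<Sum>n. ennreal (norm (c' n))) = (\<Sum>n. (\<lambda>(k, j). ennreal (norm (c k j))) (prod_decode n))"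
    by (simp add: c'_def case_prod_unfold)
  also have "\<dots> = (\<Sum>k. \<Sum>j. ennreal (norm (c k j)))"
    by (intro suminf_ennreal_2dimen) simp
  also have "\<dots> \<le> (\<Sum>k. ennreal (N k))"
  proof (intro suminf_le allI)
    fix k
    have "(\<Sum>j. ennreal (norm (c k j))) = ennreal (\<Sum>j. norm (c k j))"
      using cA(2) by (intro suminf_ennreal2) auto
    then show "(\<Sum>j. ennreal (norm (c k j))) \<le> ennreal (N k)" using cA(3) by (simp add: ennreal_leI)
  qed auto
  also have "\<dots> = ennreal (suminf N)" using N Nk by (intro suminf_ennreal2) auto
  also have "\<dots> \<le> ennreal N'" using N by (intro ennreal_leI)
  finally have le: "(\<Sum>n. ennreal (norm (c' n))) \<le> ennreal N'" .
  then have sm: "summable (\<lambda>n. norm (c' n))" by (intro summable_suminf_not_top) (auto simp: top_unique)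
  have N'0: "0 \<le> N'" using N Nk suminf_nonneg[of N] by simp
  have le': "(\<Sum>n. norm (c' n)) \<le> N'"
    using le N'0 sm by (subst (asm) suminf_ennreal2) (auto simp: ennreal_le_iff)
  have "AE z in rho. \<forall>k. (\<lambda>j. c k j * A k j z) sums g k z"
    using cA(4) by (simp add: AE_all_countable)
  with atomic_series_AE_summable[where A = A', OF p A' sm] h
  have "AE z in rho. (\<lambda>n. c' n * A' n z) sums h z"
  proof eventually_elim
    case (elim z)
    have eq: "c' n * A' n z = (case prod_decode n of (k, j) \<Rightarrow> c k j * A k j z)" for n
      by (simp add: c'_def A'_def split: prod.split)
    show ?case
      unfolding eq
      using elim unfolding eq by (intro sums_prod_decode[where g = "\<lambda>k. g k z"]) auto
  qed
  then show ?thesis unfolding atomic_sum_def using A' sm le' by blast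
qed

text \<open>
  Functions satisfying \<open>atomic_sum\<close> need not be measurable, as they are determined only
  almost everywhere; a measurable majorant makes their \<open>L\<^sup>1\<close> size available.
\<close>

lemma atomic_sum_dominated:
  fixes h :: "(real^'n) \<times> real \<Rightarrow> complex"
  assumes p: "1 < p" and h: "atomic_sum p N h"
  obtains F :: "(real^'n) \<times> real \<Rightarrow> ennreal" where "F \<in> borel_measurable rho"
    "AE z in rho. ennreal (norm (h z)) \<le> F z" "(\<integral>\<^sup>+z. F z \<partial>rho) \<le> ennreal (2 * N)"
proof -
  obtain c A where A: "\<And>j. atom p (A j)" and c: "summable (\<lambda>j. norm (c j))" "(\<Sum>j. norm (c j)) \<le> N"
    and s: "AE z in rho. (\<lambda>j. c j * A j z) sums h z"
    using h unfolding atomic_sum_def by blast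
  note [measurable] = atom_L1(1)[OF p A]
  show ?thesis
  proof (rule that[of "\<lambda>z. \<Sum>j. ennreal (norm (c j * A j z))"])
    show "AE z in rho. ennreal (norm (h z)) \<le> (\<Sum>j. ennreal (norm (c j * A j z)))"
      using s atomic_series_AE_summable[where A = A, OF p A c(1)]
    proof eventually_elim
      case (elim z)
      have "norm (h z) \<le> (\<Sum>j. norm (c j * A j z))"
        using summable_norm[OF elim(2)] elim(1) by (simp add: sums_iff)
      then show ?case using elim(2) by (subst suminf_ennreal2) (auto intro: ennreal_leI)
    qed
    have "(\<integral>\<^sup>+z. (\<Sum>j. ennreal (norm (c j * A j z))) \<partial>rho) \<le> ennreal (2 * (\<Sum>j. norm (c j)))"
      by (rule atomic_series_nn_integral[where A = A, OF p A c(1)])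
    also have "\<dots> \<le> ennreal (2 * N)" using c(2) by (intro ennreal_leI) simp
    finally show "(\<integral>\<^sup>+z. (\<Sum>j. ennreal (norm (c j * A j z))) \<partial>rho) \<le> ennreal (2 * N)" .
  qed measurable
qed

text \<open>
  Reducing every atom of a decomposition splits off a sum of \<open>(1,\<infinity>)\<close>-atoms and halves the total
  coefficient of the remainder.
\<close>

lemma atomic_sum_step:
  assumes q: "q > 1"
  obtains K :: real where "K \<ge> 0" "\<And>(h :: (real^'n) \<times> real \<Rightarrow> complex) N. atomic_sum (ennreal q) N h \<Longrightarrow>
    \<exists>g. atomic_sum \<infinity> (K * N) g \<and> atomic_sum (ennreal q) (N / 2) (\<lambda>z. h z - g z)"
proof -
  have q': "1 < ennreal q" using q by (metis ennreal_1 ennreal_less_iff zero_le_one)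
  define K where "K = (1 + (2::real) ^ CARD('n)) * (8 * (1 + 2 ^ CARD('n))) powr (1 / (q - 1))"
  have K: "K \<ge> 0" by (simp add: K_def)
  show ?thesis
  proof (rule that[OF K])
    fix h :: "(real^'n) \<times> real \<Rightarrow> complex" and N
    assume "atomic_sum (ennreal q) N h"
    then obtain c A where A: "\<And>j. atom (ennreal q) (A j)" and c: "summable (\<lambda>j. norm (c j))" "(\<Sum>j. norm (c j)) \<le> N"
      and s: "AE z in rho. (\<lambda>j. c j * A j z) sums h z"
      unfolding atomic_sum_def by blast
    have "\<forall>j. \<exists>g. atom \<infinity> g \<and> atomic_sum (ennreal q) (1 / 2) (\<lambda>z. A j z - of_real K * g z)"
      using atom_reduction[OF q A] unfolding K_def by blast
    from choice[OF this] obtain G where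
      "\<forall>j. atom \<infinity> (G j) \<and> atomic_sum (ennreal q) (1 / 2) (\<lambda>z. A j z - of_real K * G j z)" ..
    then have G: "\<And>j. atom \<infinity> (G j)" "\<And>j. atomic_sum (ennreal q) (1 / 2) (\<lambda>z. A j z - of_real K * G j z)"
      by simp_all
    define d where "d j = c j * of_real K" for j
    have nd: "norm (d j) = K * norm (c j)" for j using K by (simp add: d_def norm_mult)
    have d: "summable (\<lambda>j. norm (d j))" "(\<Sum>j. norm (d j)) \<le> K * N"
      unfolding nd using c K by (auto simp: suminf_mult summable_mult mult_left_mono)
    define g where "g z = (\<Sum>j. d j * G j z)" for z
    have gs: "AE z in rho. (\<lambda>j. d j * G j z) sums g z"
      using atomic_series_AE_summable[where A = G, OF _ G(1) d(1)]
      by (auto simp: g_def elim!: eventually_mono intro!: summable_sums dest: summable_norm_cancel)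
    have "atomic_sum \<infinity> (K * N) g"
      unfolding atomic_sum_def using G(1) d gs by blast
    moreover have "atomic_sum (ennreal q) (N / 2) (\<lambda>z. h z - g z)"
    proof (rule atomic_sum_series[OF q'])
      show "atomic_sum (ennreal q) (norm (c j) * (1 / 2)) (\<lambda>z. c j * (A j z - of_real K * G j z))" for j
        by (rule atomic_sum_scale[OF G(2)])
      show "summable (\<lambda>j. norm (c j) * (1 / 2))" using c by (intro summable_mult2)
      show "(\<Sum>j. norm (c j) * (1 / 2)) \<le> N / 2" using c by (subst suminf_mult2[symmetric]) auto
      show "AE z in rho. (\<lambda>j. c j * (A j z - of_real K * G j z)) sums (h z - g z)"
        using s gs
      proof eventually_elim
        case (elim z)
        show ?case using sums_diff[OF elim] by (simp add: d_def algebra_simps)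
      qed
    qed
    ultimately show "\<exists>g. atomic_sum \<infinity> (K * N) g \<and> atomic_sum (ennreal q) (N / 2) (\<lambda>z. h z - g z)" by blast
  qed
qed

text \<open>
  Iterating the splitting, the remainders \<open>r n\<close> have \<open>L\<^sup>1\<close> size of order \<open>N / 2\<^sup>n\<close>, hence they are
  summable and tend to \<open>0\<close> almost everywhere; the parts split off add up to \<open>h\<close> with total
  coefficient at most \<open>2 K N\<close>.
\<close>

lemma atomic_sum_imp_top:
  assumes q: "q > 1"
  obtains K :: real where "K > 0" "\<And>(h :: (real^'n) \<times> real \<Rightarrow> complex) N. atomic_sum (ennreal q) N h \<Longrightarrow>
    atomic_sum \<infinity> (K * N) h"
proof -
  have q': "1 < ennreal q" using q by (metis ennreal_1 ennreal_less_iff zero_le_one)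
  obtain K :: real where K: "K \<ge> 0" and step: "\<And>(h :: (real^'n) \<times> real \<Rightarrow> complex) N. atomic_sum (ennreal q) N h \<Longrightarrow>
    \<exists>g. atomic_sum \<infinity> (K * N) g \<and> atomic_sum (ennreal q) (N / 2) (\<lambda>z. h z - g z)"
    using atomic_sum_step[OF q] by blast
  have main: "atomic_sum \<infinity> (2 * K * N) h" if h: "atomic_sum (ennreal q) N h" for h :: "(real^'n) \<times> real \<Rightarrow> complex" and N
  proof -
    have "\<exists>r. \<forall>n. ((n = 0 \<longrightarrow> r n = h) \<and> atomic_sum (ennreal q) (N / 2 ^ n) (r n)) \<and>
      atomic_sum \<infinity> (K * (N / 2 ^ n)) (\<lambda>z. r n z - r (Suc n) z)"
    proof (rule dependent_nat_choice)
      fix x n assume "(n = 0 \<longrightarrow> x = h) \<and> atomic_sum (ennreal q) (N / 2 ^ n) x"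
      then obtain g where "atomic_sum \<infinity> (K * (N / 2 ^ n)) g" "atomic_sum (ennreal q) (N / 2 ^ n / 2) (\<lambda>z. x z - g z)"
        using step by blast
      then show "\<exists>y. ((Suc n = 0 \<longrightarrow> y = h) \<and> atomic_sum (ennreal q) (N / 2 ^ Suc n) y) \<and>
        atomic_sum \<infinity> (K * (N / 2 ^ n)) (\<lambda>z. x z - y z)"
        by (intro exI[of _ "\<lambda>z. x z - g z"]) (simp add: mult.commute)
    qed (use h in auto)
    then obtain r where "\<forall>n. ((n = 0 \<longrightarrow> r n = h) \<and> atomic_sum (ennreal q) (N / 2 ^ n) (r n)) \<and>
      atomic_sum \<infinity> (K * (N / 2 ^ n)) (\<lambda>z. r n z - r (Suc n) z)" ..
    then have r0: "r 0 = h" and r: "\<And>n. atomic_sum (ennreal q) (N / 2 ^ n) (r n)"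
      and g: "\<And>n. atomic_sum \<infinity> (K * (N / 2 ^ n)) (\<lambda>z. r n z - r (Suc n) z)" by simp_all
    have half: "(\<lambda>n. N / 2 ^ n) sums (2 * N)"
      using sums_mult[OF geometric_sums[of "1 / 2 :: real"], of N] by (simp add: power_divide mult.commute)
    have N0: "N \<ge> 0"
    proof -
      obtain c A where "summable (\<lambda>j. norm (c j :: complex))" "(\<Sum>j. norm (c j)) \<le> N"
        using h unfolding atomic_sum_def by blast
      then show ?thesis using suminf_nonneg[of "\<lambda>j. norm (c j)"] by simp
    qed
    have "\<forall>n. \<exists>F::(real^'n) \<times> real \<Rightarrow> ennreal. F \<in> borel_measurable rho \<and>
      (AE z in rho. ennreal (norm (r n z)) \<le> F z) \<and> (\<integral>\<^sup>+z. F z \<partial>rho) \<le> ennreal (2 * (N / 2 ^ n))"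
    proof
      fix n
      show "\<exists>F::(real^'n) \<times> real \<Rightarrow> ennreal. F \<in> borel_measurable rho \<and>
        (AE z in rho. ennreal (norm (r n z)) \<le> F z) \<and> (\<integral>\<^sup>+z. F z \<partial>rho) \<le> ennreal (2 * (N / 2 ^ n))"
        by (rule atomic_sum_dominated[OF q' r[of n]]) blast
    qed
    from choice[OF this] obtain F :: "nat \<Rightarrow> (real^'n) \<times> real \<Rightarrow> ennreal" where "\<forall>n. F n \<in> borel_measurable rho \<and>
      (AE z in rho. ennreal (norm (r n z)) \<le> F n z) \<and> (\<integral>\<^sup>+z. F n z \<partial>rho) \<le> ennreal (2 * (N / 2 ^ n))" ..
    then have F: "\<And>n. F n \<in> borel_measurable rho"
      "\<And>n. AE z in rho. ennreal (norm (r n z)) \<le> F n z" "\<And>n. (\<integral>\<^sup>+z. F n z \<partial>rho) \<le> ennreal (2 * (N / 2 ^ n))"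
      by simp_all
    note [measurable] = F(1)
    have "(\<integral>\<^sup>+z. (\<Sum>n. F n z) \<partial>rho) = (\<Sum>n. \<integral>\<^sup>+z. F n z \<partial>rho)" by (intro nn_integral_suminf) auto
    also have "\<dots> \<le> (\<Sum>n. ennreal (2 * (N / 2 ^ n)))" using F(3) by (intro suminf_le) auto
    also have "\<dots> = ennreal (\<Sum>n. 2 * (N / 2 ^ n))"
      using sums_mult[OF half, of 2] N0 by (intro suminf_ennreal2) (auto simp: sums_iff)
    finally have "(\<integral>\<^sup>+z. (\<Sum>n. F n z) \<partial>rho) \<noteq> \<infinity>" by (auto simp: top_unique)
    then have "AE z in rho. (\<Sum>n. F n z) \<noteq> \<infinity>" by (intro nn_integral_noteq_infinite) auto
    moreover have "AE z in rho. \<forall>n. ennreal (norm (r n z)) \<le> F n z" using F(2) by (simp add: AE_all_countable)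
    ultimately have sums: "AE z in rho. (\<lambda>n. r n z - r (Suc n) z) sums h z"
    proof eventually_elim
      case (elim z)
      have "(\<Sum>n. ennreal (norm (r n z))) \<le> (\<Sum>n. F n z)" using elim(2) by (intro suminf_le) auto
      then have "summable (\<lambda>n. norm (r n z))" using elim(1) by (intro summable_suminf_not_top) (auto simp: top_unique)
      then have "(\<lambda>n. r n z) \<longlonglongrightarrow> 0" using summable_LIMSEQ_zero tendsto_norm_zero_iff by blast
      then show ?case using telescope_sums'[of "\<lambda>n. r n z" 0] by (simp add: r0)
    qed
    show ?thesis
      by (rule atomic_sum_series[OF _ g _ _ sums])
        (use sums_mult[OF half, of K] in \<open>auto simp: sums_iff mult_ac\<close>)
  qed
  \<comment> \<open>enlarging the constant makes it positive, which is needed to divide by it\<close>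
  have "atomic_sum \<infinity> ((2 * K + 1) * N) h" if hN: "atomic_sum (ennreal q) N h" for h :: "(real^'n) \<times> real \<Rightarrow> complex" and N
  proof -
    obtain c A where 1: "\<forall>j. atom \<infinity> (A j)" "summable (\<lambda>j. norm (c j :: complex))" "(\<Sum>j. norm (c j)) \<le> 2 * K * N"
      "AE z in rho. (\<lambda>j. c j * A j z) sums h z"
      using main[OF hN] unfolding atomic_sum_def by blast
    obtain c' where "summable (\<lambda>j. norm (c' j :: complex))" "(\<Sum>j. norm (c' j)) \<le> N"
      using hN unfolding atomic_sum_def by blast
    then have "0 \<le> N" using suminf_nonneg[of "\<lambda>j. norm (c' j)"] by simp
    then have "2 * K * N \<le> (2 * K + 1) * N" by (simp add: algebra_simps)
    then show ?thesis unfolding atomic_sum_def using 1 order_trans by blast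
  qed
  then show ?thesis using that[of "2 * K + 1"] K by simp
qed

section \<open>Equivalence of the atomic spaces\<close>

lemma atomic_decomp_imp_sum:
  assumes "1 < p" "integrable rho h" "atomic_decomp p h c A"
  shows "atomic_sum p (\<Sum>j. norm (c j)) h"
  using assms unfolding atomic_sum_def by (auto simp: atomic_decomp_iff)

lemma atomic_sum_imp_decomp:
  assumes "1 < p" "integrable rho h" "atomic_sum p N h"
  obtains c A where "atomic_decomp p h c A" "(\<Sum>j. norm (c j)) \<le> N"
  using assms unfolding atomic_sum_def by (auto simp: atomic_decomp_iff)

lemma H1_iff:
  assumes "1 < p"
  shows "h \<in> H1 p \<longleftrightarrow> integrable rho h \<and> (\<exists>N. atomic_sum p N h)"
proof
  assume "h \<in> H1 p"
  then show "integrable rho h \<and> (\<exists>N. atomic_sum p N h)"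
    using atomic_decomp_imp_sum[OF assms] by (auto simp: H1_def)
next
  assume h: "integrable rho h \<and> (\<exists>N. atomic_sum p N h)"
  then obtain N where N: "atomic_sum p N h" by blast
  obtain c A where "atomic_decomp p h c A" using atomic_sum_imp_decomp[OF assms _ N] h by blast
  then show "h \<in> H1 p" using h unfolding H1_def by blast
qed

lemma H1_norm_le:
  assumes "1 < p" "integrable rho h" "atomic_sum p N h"
  shows "H1_norm p h \<le> N"
proof -
  obtain c A where d: "atomic_decomp p h c A" "(\<Sum>j. norm (c j)) \<le> N"
    using atomic_sum_imp_decomp[OF assms] .
  have "bdd_below {(\<Sum>j. norm (c j)) |c. \<exists>A. atomic_decomp p h c A}"
    by (rule bdd_belowI[of _ 0]) (auto simp: atomic_decomp_def intro!: suminf_nonneg)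
  then have "H1_norm p h \<le> (\<Sum>j. norm (c j))"
    unfolding H1_norm_def using d(1) by (intro cInf_lower) auto
  then show ?thesis using d(2) by simp
qed

lemma H1_norm_ge:
  assumes "1 < p" "h \<in> H1 p" "\<And>N. atomic_sum p N h \<Longrightarrow> B \<le> N"
  shows "B \<le> H1_norm p h"
  unfolding H1_norm_def
proof (rule cInf_greatest)
  show "{(\<Sum>j. norm (c j)) |c. \<exists>A. atomic_decomp p h c A} \<noteq> {}" using assms(2) by (auto simp: H1_def)
  fix x assume "x \<in> {(\<Sum>j. norm (c j)) |c. \<exists>A. atomic_decomp p h c A}"
  then obtain c A where c: "x = (\<Sum>j. norm (c j))" "atomic_decomp p h c A" by blast
  have "integrable rho h" using assms(2) by (simp add: H1_def)
  then show "B \<le> x" unfolding c(1) using c(2) by (intro assms(3) atomic_decomp_imp_sum[OF assms(1)])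
qed

theorem theorem2p3:
  fixes p :: ennreal
  assumes "1 < p" and "p < \<infinity>"
  shows "(H1 p :: ((real ^ 'n) \<times> real \<Rightarrow> complex) set) = H1 \<infinity> \<and>
    (\<exists>C1 > 0. \<exists>C2 > 0. \<forall>h \<in> (H1 \<infinity> :: ((real ^ 'n) \<times> real \<Rightarrow> complex) set).
       C1 * H1_norm \<infinity> h \<le> H1_norm p h \<and> H1_norm p h \<le> C2 * H1_norm \<infinity> h)"
proof -
  obtain q where q: "p = ennreal q" "q > 1"
    using assms(1) by (rule exponent_cases) (use assms(2) in auto)
  have top: "1 < (\<infinity>::ennreal)" by simp
  obtain K :: real where K: "K > 0" and down: "\<And>(h :: (real^'n) \<times> real \<Rightarrow> complex) N. atomic_sum p N h \<Longrightarrow> atomic_sum \<infinity> (K * N) h"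
    using atomic_sum_imp_top[OF q(2)] unfolding q(1) by blast
  have up: "atomic_sum p N h" if "atomic_sum \<infinity> N h" for h :: "(real^'n) \<times> real \<Rightarrow> complex" and N
    using that atom_top_imp_atom[OF _ q(2)] unfolding atomic_sum_def q(1) by blast
  have eq: "(H1 p :: ((real ^ 'n) \<times> real \<Rightarrow> complex) set) = H1 \<infinity>"
    using up down unfolding set_eq_iff H1_iff[OF assms(1)] H1_iff[OF top] by blast
  have "1 / K * H1_norm \<infinity> h \<le> H1_norm p h \<and> H1_norm p h \<le> 1 * H1_norm \<infinity> h"
    if h: "h \<in> H1 \<infinity>" for h :: "(real^'n) \<times> real \<Rightarrow> complex"
  proof
    have hint: "integrable rho h" using h by (simp add: H1_def)
    have "h \<in> H1 p" using h eq by simp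
    then show "1 / K * H1_norm \<infinity> h \<le> H1_norm p h"
    proof (rule H1_norm_ge[OF assms(1)])
      fix N assume "atomic_sum p N h"
      then have "H1_norm \<infinity> h \<le> K * N" using H1_norm_le[OF top hint down] by blast
      then show "1 / K * H1_norm \<infinity> h \<le> N" using K by (simp add: field_simps)
    qed
    have "H1_norm p h \<le> H1_norm \<infinity> h"
      using H1_norm_ge[OF top h] H1_norm_le[OF assms(1) hint up] by blast
    then show "H1_norm p h \<le> 1 * H1_norm \<infinity> h" by simp
  qed
  then show ?thesis using eq K by (intro conjI exI[of _ "1 / K"] exI[of _ 1]) auto
qed

end
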